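(* Let $k$ be a commutative ring, $H$ a weak bialgebra over $k$, and $M,N$ right $H$-comodules. Then $M$ and $N$ are $H_s$-bimodules and $H_s$-bicomodules (with the structures given in the context), and $$M\otimes^{H_s}N=M\otimes^r N\cong M\otimes_r N=M\otimes_{H_s}N,$$ where the first equality is an equality of submodules of $M\otimes N$, and the last one an equality of quotients of $M\otimes N$.
   Context: Conventions. $k$ is a commutative ring and $\otimes=\otimes_k$. A $k$-prebialgebra is a $k$-module $H$ that is both an associative unital $k$-algebra (unit $1$) and a coassociative counital $k$-coalgebra ($\Delta$, $\varepsilon$) such that $\Delta(hk)=\Delta(h)\Delta(k)$ for all $h,k\in H$. Sweedler notation: $\Delta(h)=h_{(1)}\otimes h_{(2)}$, $\Delta(1)=1_{(1)}\otimes 1_{(2)}=1_{(1')}\otimes 1_{(2')}$, $\Delta^2=(\Delta\otimes H)\circ\Delta$; right $H$-coactions are written $m\mapsto m_{[0]}\otimes m_{[1]}$. A weak bialgebra is a prebialgebra satisfying all four axioms (for all $h,k,l\in H$): (lm) $\varepsilon(hkl)=\varepsilon(hk_{(1)})\varepsilon(k_{(2)}l)$; (rm) $\varepsilon(hkl)=\varepsilon(hk_{(2)})\varepsilon(k_{(1)}l)$; (lc) $\Delta^2(1)=1_{(1)}\otimes 1_{(2)}1_{(1')}\otimes 1_{(2')}$; (rc) $\Delta^2(1)=1_{(1)}\otimes 1_{(1')}1_{(2)}\otimes 1_{(2')}$. Let $\varepsilon_s(h)=\langle\varepsilon,h1_{(2)}\rangle 1_{(1)}$, $\overline{\varepsilon}_s(h)=\langle\varepsilon,1_{(2)}h\rangle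 1_{(1)}$, and $H_s=\mathrm{Im}(\varepsilon_s)$; for a weak bialgebra also $H_s=\mathrm{Im}(\overline{\varepsilon}_s)$. $H_s$ is a subalgebra of $H$, and a coalgebra with comultiplication $\Delta_s(y)=\varepsilon_s(1_{(1)})\otimes\varepsilon_s(y1_{(2)})$ and counit $\varepsilon|_{H_s}$. On a right $H$-comodule $M$ the $H_s$-actions are $y\triangleright m=\langle\varepsilon,ym_{[1]}\rangle m_{[0]}$ and $m\triangleleft y=\langle\varepsilon,m_{[1]}y\rangle m_{[0]}$, and the right and left $H_s$-coactions are $m\mapsto m_{[0]}\otimes\varepsilon_s(m_{[1]})$ and $m\mapsto\overline{\varepsilon}_s(m_{[1]})\otimes m_{[0]}$. For right $H$-comodules $M,N$, let $\pi:M\otimes N\to M\otimes N$, $\pi(m\otimes n)=\langle\varepsilon,m_{[1]}n_{[1]}\rangle m_{[0]}\otimes n_{[0]}$ (an idempotent map), $M\otimes^r N=\mathrm{Im}(\pi)$ and $M\otimes_r N=(M\otimes N)/\mathrm{Ker}(\pi)$. The isomorphism $M\otimes_r N\cong M\otimes^r N$ is the one induced by $\pi$. $M\otimes^{H_s}N$ is the cotensor product, i.e. the set of $\sum_i m_i\otimes n_i\in M\otimes N$ with $\sum_i m_{i[0]}\otimes\varepsilon_s(m_{i[1]})\otimes n_i=\sum_i m_i\otimes\overline{\varepsilon}_s(n_{i[1]})\otimes n_{i[0]}$. $M\otimes_{H_s}N$ is the quotient of $M\otimes N$ by the submodule generated by all $m\triangleleft y\otimes n-m\otimes y\triangleright n$.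 *)

theory Defs
  imports "HOL.Hull" "HOL-Algebra.Module" "HOL-Algebra.AbelCoset"
begin

section \<open>Linear maps, quotients and free modules\<close>

text \<open>
  Modules are records of type \<open>('k, 'm) module\<close>. These records also have ring multiplication
  fields; they are used for algebras only, and are left \<open>undefined\<close> in the plain
  modules constructed below.
\<close>

definition module_hom ::
    "('k, 'r) ring_scheme \<Rightarrow> ('k, 'm, 'x) module_scheme \<Rightarrow> ('k, 'n, 'y) module_scheme \<Rightarrow> ('m \<Rightarrow> 'n) set"
  where "module_hom R M N =
    {f. f \<in> carrier M \<rightarrow> carrier N
      \<and> (\<forall>x \<in> carrier M. \<forall>y \<in> carrier M. f (x \<oplus>\<^bsub>M\<^esub> y) = f x \<oplus>\<^bsub>N\<^esub> f y)
      \<and> (\<forall>a \<in> carrier R. \<forall>x \<in> carrier M. f (a \<odot>\<^bsub>M\<^esub> x) = a \<odot>\<^bsub>N\<^esub> f x)}"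

definition module_iso ::
    "('k, 'r) ring_scheme \<Rightarrow> ('k, 'm, 'x) module_scheme \<Rightarrow> ('k, 'n, 'y) module_scheme \<Rightarrow> ('m \<Rightarrow> 'n) set"
  where "module_iso R M N = {f \<in> module_hom R M N. bij_betw f (carrier M) (carrier N)}"

definition bilinear_map ::
    "('k, 'r) ring_scheme \<Rightarrow> ('k, 'm, 'x) module_scheme \<Rightarrow> ('k, 'n, 'y) module_scheme
      \<Rightarrow> ('k, 'p, 'z) module_scheme \<Rightarrow> ('m \<Rightarrow> 'n \<Rightarrow> 'p) \<Rightarrow> bool"
  where "bilinear_map R M N P b \<longleftrightarrow>
    (\<forall>m \<in> carrier M. b m \<in> module_hom R N P) \<and>
    (\<forall>n \<in> carrier N. (\<lambda>m. b m n) \<in> module_hom R M P)"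

definition generated_submodule ::
    "('k, 'r) ring_scheme \<Rightarrow> ('k, 'm, 'x) module_scheme \<Rightarrow> 'm set \<Rightarrow> 'm set"
  where "generated_submodule R M S = (\<lambda>L. submodule L R M) hull S"

definition quotient_module ::
    "('k, 'm, 'x) module_scheme \<Rightarrow> 'm set \<Rightarrow> ('k, 'm set) module"
  where "quotient_module M L =
    \<lparr>carrier = a_rcosets\<^bsub>M\<^esub> L, mult = undefined, one = undefined,
     zero = L, add = set_add M,
     smult = (\<lambda>a X. \<Union>x \<in> X. L +>\<^bsub>M\<^esub> (a \<odot>\<^bsub>M\<^esub> x))\<rparr>"

definition scalar_module :: "('k, 'r) ring_scheme \<Rightarrow> ('k, 'k) module"
  where "scalar_module R =
    \<lparr>carrier = carrier R, mult = mult R, one = one R, zero = zero R, add = add R,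
     smult = mult R\<rparr>"

text \<open>The free module on \<open>S\<close>: finitely supported families of scalars, zero outside \<open>S\<close>.\<close>

definition free_module :: "('k, 'r) ring_scheme \<Rightarrow> 's set \<Rightarrow> ('k, 's \<Rightarrow> 'k) module"
  where "free_module R S =
    \<lparr>carrier = {f. (\<forall>s. f s \<in> carrier R) \<and> finite {s. f s \<noteq> \<zero>\<^bsub>R\<^esub>} \<and> {s. f s \<noteq> \<zero>\<^bsub>R\<^esub>} \<subseteq> S},
     mult = undefined, one = undefined,
     zero = (\<lambda>s. \<zero>\<^bsub>R\<^esub>), add = (\<lambda>f g s. f s \<oplus>\<^bsub>R\<^esub> g s),
     smult = (\<lambda>a f s. a \<otimes>\<^bsub>R\<^esub> f s)\<rparr>"

definition free_gen :: "('k, 'r) ring_scheme \<Rightarrow> 's \<Rightarrow> 's \<Rightarrow> 'k"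
  where "free_gen R s = (\<lambda>t. if t = s then \<one>\<^bsub>R\<^esub> else \<zero>\<^bsub>R\<^esub>)"

section \<open>Tensor products\<close>

definition tensor_relations ::
    "('k, 'r) ring_scheme \<Rightarrow> ('k, 'm, 'x) module_scheme \<Rightarrow> ('k, 'n, 'y) module_scheme
      \<Rightarrow> ('m \<times> 'n \<Rightarrow> 'k) set"
  where "tensor_relations R M N =
    (let F = free_module R (carrier M \<times> carrier N); d = free_gen R in
      {d (x \<oplus>\<^bsub>M\<^esub> x', y) \<ominus>\<^bsub>F\<^esub> (d (x, y) \<oplus>\<^bsub>F\<^esub> d (x', y)) | x x' y.
          x \<in> carrier M \<and> x' \<in> carrier M \<and> y \<in> carrier N}
    \<union> {d (x, y \<oplus>\<^bsub>N\<^esub> y') \<ominus>\<^bsub>F\<^esub> (d (x, y) \<oplus>\<^bsub>F\<^esub> d (x, y')) | x y y'.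
          x \<in> carrier M \<and> y \<in> carrier N \<and> y' \<in> carrier N}
    \<union> {d (a \<odot>\<^bsub>M\<^esub> x, y) \<ominus>\<^bsub>F\<^esub> a \<odot>\<^bsub>F\<^esub> d (x, y) | a x y.
          a \<in> carrier R \<and> x \<in> carrier M \<and> y \<in> carrier N}
    \<union> {d (x, a \<odot>\<^bsub>N\<^esub> y) \<ominus>\<^bsub>F\<^esub> a \<odot>\<^bsub>F\<^esub> d (x, y) | a x y.
          a \<in> carrier R \<and> x \<in> carrier M \<and> y \<in> carrier N})"

definition tensor_kernel ::
    "('k, 'r) ring_scheme \<Rightarrow> ('k, 'm, 'x) module_scheme \<Rightarrow> ('k, 'n, 'y) module_scheme
      \<Rightarrow> ('m \<times> 'n \<Rightarrow> 'k) set"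
  where "tensor_kernel R M N =
    generated_submodule R (free_module R (carrier M \<times> carrier N)) (tensor_relations R M N)"

definition tensor ::
    "('k, 'r) ring_scheme \<Rightarrow> ('k, 'm, 'x) module_scheme \<Rightarrow> ('k, 'n, 'y) module_scheme
      \<Rightarrow> ('k, ('m \<times> 'n \<Rightarrow> 'k) set) module"
  where "tensor R M N =
    quotient_module (free_module R (carrier M \<times> carrier N)) (tensor_kernel R M N)"

definition pure ::
    "('k, 'r) ring_scheme \<Rightarrow> ('k, 'm, 'x) module_scheme \<Rightarrow> ('k, 'n, 'y) module_scheme
      \<Rightarrow> 'm \<Rightarrow> 'n \<Rightarrow> ('m \<times> 'n \<Rightarrow> 'k) set"
  where "pure R M N x y =
    tensor_kernel R M N +>\<^bsub>free_module R (carrier M \<times> carrier N)\<^esub> free_gen R (x, y)"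

text \<open>
  \<open>tensor_lift R M N P b\<close> is the unique linear map \<open>M \<otimes> N \<rightarrow> P\<close> sending \<open>x \<otimes> y\<close> to
  \<open>b x y\<close>, for bilinear \<open>b\<close>; existence and uniqueness are proved in \<open>tensor_lift_unique\<close> below.
  It renders Sweedler notation: \<open>tensor_lift R H H P b (\<Delta> h)\<close> is the value of the
  expression \<open>b h\<^sub>(\<^sub>1\<^sub>) h\<^sub>(\<^sub>2\<^sub>)\<close>.
\<close>

definition tensor_lift ::
    "('k, 'r) ring_scheme \<Rightarrow> ('k, 'm, 'x) module_scheme \<Rightarrow> ('k, 'n, 'y) module_scheme
      \<Rightarrow> ('k, 'p, 'z) module_scheme \<Rightarrow> ('m \<Rightarrow> 'n \<Rightarrow> 'p) \<Rightarrow> ('m \<times> 'n \<Rightarrow> 'k) set \<Rightarrow> 'p"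
  where "tensor_lift R M N P b =
    (THE f. f \<in> module_hom R (tensor R M N) P \<and> f \<in> extensional (carrier (tensor R M N)) \<and>
       (\<forall>x \<in> carrier M. \<forall>y \<in> carrier N. f (pure R M N x y) = b x y))"

section \<open>The universal property of the tensor product\<close>

lemma (in abelian_group) a_minus_eq_zero_iff:
  "\<lbrakk>x \<in> carrier G; y \<in> carrier G\<rbrakk> \<Longrightarrow> x \<ominus> y = \<zero> \<longleftrightarrow> x = y"
  by (metis a_inv_closed add.inv_solve_right' l_zero minus_eq r_neg zero_closed)

lemma module_homI:
  assumes "\<And>x. x \<in> carrier M \<Longrightarrow> f x \<in> carrier N"
    and "\<And>x y. \<lbrakk>x \<in> carrier M; y \<in> carrier M\<rbrakk> \<Longrightarrow> f (x \<oplus>\<^bsub>M\<^esub> y) = f x \<oplus>\<^bsub>N\<^esub> f y"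
    and "\<And>a x. \<lbrakk>a \<in> carrier R; x \<in> carrier M\<rbrakk> \<Longrightarrow> f (a \<odot>\<^bsub>M\<^esub> x) = a \<odot>\<^bsub>N\<^esub> f x"
  shows "f \<in> module_hom R M N"
  using assms by (auto simp: module_hom_def)

lemma module_homD:
  assumes "f \<in> module_hom R M N"
  shows "x \<in> carrier M \<Longrightarrow> f x \<in> carrier N"
    and "\<lbrakk>x \<in> carrier M; y \<in> carrier M\<rbrakk> \<Longrightarrow> f (x \<oplus>\<^bsub>M\<^esub> y) = f x \<oplus>\<^bsub>N\<^esub> f y"
    and "\<lbrakk>a \<in> carrier R; x \<in> carrier M\<rbrakk> \<Longrightarrow> f (a \<odot>\<^bsub>M\<^esub> x) = a \<odot>\<^bsub>N\<^esub> f x"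
  using assms by (auto simp: module_hom_def)

lemma (in module) module_hom_zero:
  assumes "module R N" "f \<in> module_hom R M N"
  shows "f \<zero>\<^bsub>M\<^esub> = \<zero>\<^bsub>N\<^esub>"
proof -
  interpret N: module R N by fact
  have "f (\<zero> \<odot>\<^bsub>M\<^esub> \<zero>\<^bsub>M\<^esub>) = \<zero> \<odot>\<^bsub>N\<^esub> f \<zero>\<^bsub>M\<^esub>"
    by (rule module_homD(3)[OF assms(2)]) auto
  then show ?thesis
    using module_homD(1)[OF assms(2)] by simp
qed

lemma (in module) module_hom_minus:
  assumes "module R N" "f \<in> module_hom R M N" "x \<in> carrier M" "y \<in> carrier M"
  shows "f (\<ominus>\<^bsub>M\<^esub> x) = \<ominus>\<^bsub>N\<^esub> f x" and "f (x \<ominus>\<^bsub>M\<^esub> y) = f x \<ominus>\<^bsub>N\<^esub> f y"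
proof -
  interpret N: module R N by fact
  have neg: "f (\<ominus>\<^bsub>M\<^esub> z) = \<ominus>\<^bsub>N\<^esub> f z" if z: "z \<in> carrier M" for z
  proof -
    have "\<ominus>\<^bsub>M\<^esub> z = (\<ominus> \<one>) \<odot>\<^bsub>M\<^esub> z" "\<ominus>\<^bsub>N\<^esub> f z = (\<ominus> \<one>) \<odot>\<^bsub>N\<^esub> f z"
      using z module_homD(1)[OF assms(2)] by (simp_all add: smult_l_minus N.smult_l_minus)
    then show ?thesis using assms(2) z by (simp add: module_homD(3))
  qed
  show "f (\<ominus>\<^bsub>M\<^esub> x) = \<ominus>\<^bsub>N\<^esub> f x" using neg assms(3) .
  show "f (x \<ominus>\<^bsub>M\<^esub> y) = f x \<ominus>\<^bsub>N\<^esub> f y"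
    using assms neg by (simp add: a_minus_def module_homD(2))
qed

lemma (in module) generated_submodule:
  assumes "S \<subseteq> carrier M"
  shows "submodule (generated_submodule R M S) R M" "S \<subseteq> generated_submodule R M S"
    and "\<And>L. submodule L R M \<Longrightarrow> S \<subseteq> L \<Longrightarrow> generated_submodule R M S \<subseteq> L"
proof -
  have sub: "submodule (carrier M) R M" by (rule carrier_is_submodule)
  show "submodule (generated_submodule R M S) R M"
  proof (rule submoduleI)
    show "generated_submodule R M S \<subseteq> carrier M"
      using sub assms by (auto simp: generated_submodule_def hull_def)
  next
    show "\<zero>\<^bsub>M\<^esub> \<in> generated_submodule R M S"
      by (auto simp: generated_submodule_def hull_def submodule_def
        dest: subgroup.one_closed)
  next
    fix a b assume ab: "a \<in> generated_submodule R M S" "b \<in> generated_submodule R M S"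
    show "a \<oplus>\<^bsub>M\<^esub> b \<in> generated_submodule R M S"
      using ab submoduleE(5) by (auto simp: generated_submodule_def hull_def)
  next
    fix a assume ab: "a \<in> generated_submodule R M S"
    show "\<ominus>\<^bsub>M\<^esub> a \<in> generated_submodule R M S"
      using ab submoduleE(3) by (auto simp: generated_submodule_def hull_def)
  next
    fix a x assume ab: "a \<in> carrier R" "x \<in> generated_submodule R M S"
    show "a \<odot>\<^bsub>M\<^esub> x \<in> generated_submodule R M S"
      using ab submoduleE(4) by (auto simp: generated_submodule_def hull_def)
  qed
  show "S \<subseteq> generated_submodule R M S"
    by (auto simp: generated_submodule_def hull_def)
  show "\<And>L. submodule L R M \<Longrightarrow> S \<subseteq> L \<Longrightarrow> generated_submodule R M S \<subseteq> L"
    by (auto simp: generated_submodule_def hull_def)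
qed

lemma (in module) hom_eq_submodule:
  assumes "module R N" "f \<in> module_hom R M N" "g \<in> module_hom R M N"
  shows "submodule {x \<in> carrier M. f x = g x} R M"
proof -
  note f = module_homD[OF assms(2)] module_hom_zero[OF assms(1,2)] module_hom_minus(1)[OF assms(1,2)]
  note g = module_homD[OF assms(3)] module_hom_zero[OF assms(1,3)] module_hom_minus(1)[OF assms(1,3)]
  show ?thesis
    by (rule submoduleI) (auto simp: f g)
qed

lemma (in module) zero_hom:
  assumes "module R N" shows "(\<lambda>_. \<zero>\<^bsub>N\<^esub>) \<in> module_hom R M N"
proof -
  interpret N: module R N by fact
  show ?thesis by (rule module_homI) auto
qed

subsection \<open>Quotients\<close>

context module begin

context fixes L assumes L: "submodule L R M" begin

interpretation L: abelian_subgroup L M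
  by (rule abelian_subgroupI3) (use L M.abelian_group_axioms in
    \<open>auto intro: additive_subgroupI submodule.axioms(1)\<close>)

lemma quotient_smult:
  assumes "a \<in> carrier R" "x \<in> carrier M"
  shows "a \<odot>\<^bsub>quotient_module M L\<^esub> (L +>\<^bsub>M\<^esub> x) = L +>\<^bsub>M\<^esub> (a \<odot>\<^bsub>M\<^esub> x)"
proof -
  have "L +>\<^bsub>M\<^esub> (a \<odot>\<^bsub>M\<^esub> y) = L +>\<^bsub>M\<^esub> (a \<odot>\<^bsub>M\<^esub> x)" if "y \<in> L +>\<^bsub>M\<^esub> x" for y
  proof -
    obtain l where l: "l \<in> L" "y = l \<oplus>\<^bsub>M\<^esub> x" using \<open>y \<in> _\<close> by (auto simp: a_r_coset_def')
    then have "a \<odot>\<^bsub>M\<^esub> y = a \<odot>\<^bsub>M\<^esub> l \<oplus>\<^bsub>M\<^esub> a \<odot>\<^bsub>M\<^esub> x"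
      using assms L.a_subset by (auto simp: smult_r_distr)
    moreover have "a \<odot>\<^bsub>M\<^esub> l \<in> L" using L assms l submoduleE(4) by blast
    ultimately have "a \<odot>\<^bsub>M\<^esub> y \<in> L +>\<^bsub>M\<^esub> (a \<odot>\<^bsub>M\<^esub> x)" by (auto simp: a_r_coset_def')
    then show ?thesis
      using M.a_repr_independence[OF _ _ L.a_subgroup] assms by simp
  qed
  moreover have "x \<in> L +>\<^bsub>M\<^esub> x" using assms L.a_rcos_self by blast
  ultimately have "(\<Union>y \<in> L +>\<^bsub>M\<^esub> x. L +>\<^bsub>M\<^esub> (a \<odot>\<^bsub>M\<^esub> y)) = L +>\<^bsub>M\<^esub> (a \<odot>\<^bsub>M\<^esub> x)"
    by blast
  then show ?thesis by (simp add: quotient_module_def)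
qed

lemma quotient_add:
  assumes "x \<in> carrier M" "y \<in> carrier M"
  shows "(L +>\<^bsub>M\<^esub> x) \<oplus>\<^bsub>quotient_module M L\<^esub> (L +>\<^bsub>M\<^esub> y) = L +>\<^bsub>M\<^esub> (x \<oplus>\<^bsub>M\<^esub> y)"
  using assms by (simp add: quotient_module_def L.a_rcos_sum)

lemma quotient_carrier: "carrier (quotient_module M L) = (\<lambda>x. L +>\<^bsub>M\<^esub> x) ` carrier M"
  by (auto simp: quotient_module_def A_RCOSETS_def')

lemma quotient_zero: "\<zero>\<^bsub>quotient_module M L\<^esub> = L +>\<^bsub>M\<^esub> \<zero>\<^bsub>M\<^esub>"
  using L.a_subset by (simp add: quotient_module_def)

lemma quotient_module: "module R (quotient_module M L)"
proof (rule moduleI)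
  show "cring R" by (rule R.is_cring)
  show "abelian_group (quotient_module M L)"
  proof (rule abelian_groupI)
    fix x assume "x \<in> carrier (quotient_module M L)"
    then obtain x' where x': "x' \<in> carrier M" "x = L +>\<^bsub>M\<^esub> x'" by (auto simp: quotient_carrier)
    show "\<exists>y \<in> carrier (quotient_module M L). y \<oplus>\<^bsub>quotient_module M L\<^esub> x = \<zero>\<^bsub>quotient_module M L\<^esub>"
      by (rule bexI[of _ "L +>\<^bsub>M\<^esub> (\<ominus>\<^bsub>M\<^esub> x')"])
        (auto simp: x' quotient_add quotient_carrier quotient_zero M.l_neg)
  next
    fix x y assume "x \<in> carrier (quotient_module M L)" "y \<in> carrier (quotient_module M L)"
    then show "x \<oplus>\<^bsub>quotient_module M L\<^esub> y = y \<oplus>\<^bsub>quotient_module M L\<^esub> x"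
      by (auto simp: quotient_carrier quotient_add M.a_comm)
  next
    fix x y z assume "x \<in> carrier (quotient_module M L)" "y \<in> carrier (quotient_module M L)"
      "z \<in> carrier (quotient_module M L)"
    then show "x \<oplus>\<^bsub>quotient_module M L\<^esub> y \<oplus>\<^bsub>quotient_module M L\<^esub> z
        = x \<oplus>\<^bsub>quotient_module M L\<^esub> (y \<oplus>\<^bsub>quotient_module M L\<^esub> z)"
      by (auto simp: quotient_carrier quotient_add M.a_assoc)
  qed (auto simp: quotient_carrier quotient_add quotient_zero)
next
  fix a x assume "a \<in> carrier R" "x \<in> carrier (quotient_module M L)"
  then show "a \<odot>\<^bsub>quotient_module M L\<^esub> x \<in> carrier (quotient_module M L)"
    by (auto simp: quotient_carrier quotient_smult)
next
  fix a b x assume "a \<in> carrier R" "b \<in> carrier R" "x \<in> carrier (quotient_module M L)"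
  then show "(a \<oplus> b) \<odot>\<^bsub>quotient_module M L\<^esub> x = a \<odot>\<^bsub>quotient_module M L\<^esub> x \<oplus>\<^bsub>quotient_module M L\<^esub> b \<odot>\<^bsub>quotient_module M L\<^esub> x"
    by (auto simp: quotient_carrier quotient_smult quotient_add smult_l_distr)
next
  fix a x y assume "a \<in> carrier R" "x \<in> carrier (quotient_module M L)" "y \<in> carrier (quotient_module M L)"
  then show "a \<odot>\<^bsub>quotient_module M L\<^esub> (x \<oplus>\<^bsub>quotient_module M L\<^esub> y) = a \<odot>\<^bsub>quotient_module M L\<^esub> x \<oplus>\<^bsub>quotient_module M L\<^esub> a \<odot>\<^bsub>quotient_module M L\<^esub> y"
    by (auto simp: quotient_carrier quotient_smult quotient_add smult_r_distr)
next
  fix a b x assume "a \<in> carrier R" "b \<in> carrier R" "x \<in> carrier (quotient_module M L)"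
  then show "(a \<otimes> b) \<odot>\<^bsub>quotient_module M L\<^esub> x = a \<odot>\<^bsub>quotient_module M L\<^esub> (b \<odot>\<^bsub>quotient_module M L\<^esub> x)"
    by (auto simp: quotient_carrier quotient_smult smult_assoc1)
next
  fix x assume "x \<in> carrier (quotient_module M L)"
  then show "\<one> \<odot>\<^bsub>quotient_module M L\<^esub> x = x"
    by (auto simp: quotient_carrier quotient_smult)
qed

lemma quotient_proj_hom: "(\<lambda>x. L +>\<^bsub>M\<^esub> x) \<in> module_hom R M (quotient_module M L)"
  by (rule module_homI) (auto simp: quotient_carrier quotient_add quotient_smult)

lemma quotient_lift:
  assumes N: "module R N" and g: "g \<in> module_hom R M N" and ker: "\<And>x. x \<in> L \<Longrightarrow> g x = \<zero>\<^bsub>N\<^esub>"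
  shows "\<exists>h \<in> module_hom R (quotient_module M L) N. \<forall>x \<in> carrier M. h (L +>\<^bsub>M\<^esub> x) = g x"
proof -
  interpret N: module R N by fact
  define h where "h = (\<lambda>X. the_elem (g ` X))"
  have h: "h (L +>\<^bsub>M\<^esub> x) = g x" if x: "x \<in> carrier M" for x
  proof -
    have "g y = g x" if "y \<in> L +>\<^bsub>M\<^esub> x" for y
    proof -
      obtain l where l: "l \<in> L" "y = l \<oplus>\<^bsub>M\<^esub> x"
        using \<open>y \<in> _\<close> by (auto simp: a_r_coset_def')
      then have "g y = g l \<oplus>\<^bsub>N\<^esub> g x"
        using module_homD(2)[OF g] x L.a_subset by blast
      then show ?thesis
        using ker[OF l(1)] module_homD(1)[OF g x] by simp
    qed
    moreover have "x \<in> L +>\<^bsub>M\<^esub> x" using x L.a_rcos_self by blast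
    ultimately have "g ` (L +>\<^bsub>M\<^esub> x) = {g x}" by blast
    then show ?thesis by (simp add: h_def)
  qed
  have "h \<in> module_hom R (quotient_module M L) N"
    by (rule module_homI) (auto simp: quotient_carrier quotient_add quotient_smult h module_homD[OF g])
  with h show ?thesis by blast
qed

end

end

subsection \<open>Free modules\<close>

lemma (in cring) free_module: "module R (free_module R S)"
proof (rule moduleI)
  show "cring R" by (rule is_cring)
  have fin: "finite {s. f s \<oplus> g s \<noteq> \<zero>} \<and> {s. f s \<oplus> g s \<noteq> \<zero>} \<subseteq> S"
    if "finite {s. f s \<noteq> \<zero>} \<and> {s. f s \<noteq> \<zero>} \<subseteq> S" "finite {s. g s \<noteq> \<zero>} \<and> {s. g s \<noteq> \<zero>} \<subseteq> S"
    for f g :: "'c \<Rightarrow> 'a"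
  proof -
    have *: "{s. f s \<oplus> g s \<noteq> \<zero>} \<subseteq> {s. f s \<noteq> \<zero>} \<union> {s. g s \<noteq> \<zero>}" by auto
    then show ?thesis using that by (meson finite_UnI finite_subset le_sup_iff order_trans)
  qed
  have fin': "finite {s. a \<otimes> g s \<noteq> \<zero>} \<and> {s. a \<otimes> g s \<noteq> \<zero>} \<subseteq> S"
    if "a \<in> carrier R" "finite {s. g s \<noteq> \<zero>} \<and> {s. g s \<noteq> \<zero>} \<subseteq> S"
    for a and g :: "'c \<Rightarrow> 'a"
  proof -
    have *: "{s. a \<otimes> g s \<noteq> \<zero>} \<subseteq> {s. g s \<noteq> \<zero>}" using that(1) by auto
    then show ?thesis using that by (meson finite_subset order_trans)
  qed
  show "abelian_group (free_module R S)"
  proof (rule abelian_groupI)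
    fix f assume f: "f \<in> carrier (free_module R S)"
    have "(\<lambda>s. (\<ominus> \<one>) \<otimes> f s) \<in> carrier (free_module R S)"
      using f fin'[of "\<ominus> \<one>" f] by (auto simp: free_module_def subset_iff image_iff)
    moreover have "(\<ominus> \<one>) \<otimes> f s \<oplus> f s = \<zero>" for s
    proof -
      have "f s \<in> carrier R" using f by (auto simp: free_module_def)
      then show ?thesis by (simp add: l_minus l_neg)
    qed
    ultimately show "\<exists>y \<in> carrier (free_module R S). y \<oplus>\<^bsub>free_module R S\<^esub> f = \<zero>\<^bsub>free_module R S\<^esub>"
      by (intro bexI) (auto simp: free_module_def)
  next
    fix f g assume "f \<in> carrier (free_module R S)" "g \<in> carrier (free_module R S)"
    then show "f \<oplus>\<^bsub>free_module R S\<^esub> g \<in> carrier (free_module R S)"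
      using fin[of f g] by (auto simp: free_module_def subset_iff image_iff)
  qed (auto simp: free_module_def subset_iff image_iff fun_eq_iff a_ac)
  fix a f assume "a \<in> carrier R" "f \<in> carrier (free_module R S)"
  then show "a \<odot>\<^bsub>free_module R S\<^esub> f \<in> carrier (free_module R S)"
    using fin'[of a f] by (auto simp: free_module_def subset_iff image_iff)
qed (auto simp: free_module_def subset_iff image_iff fun_eq_iff l_distr r_distr m_assoc)

lemma (in cring) free_gen_closed: "s \<in> S \<Longrightarrow> free_gen R s \<in> carrier (free_module R S)"
  by (auto simp: free_gen_def free_module_def)

lemma (in cring) free_module_induct:
  assumes L: "submodule L R (free_module R S)" and gen: "\<And>s. s \<in> S \<Longrightarrow> free_gen R s \<in> L"
    and f: "f \<in> carrier (free_module R S)"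
  shows "f \<in> L"
proof -
  interpret F: module R "free_module R S" by (rule free_module)
  have "f \<in> L" if "finite A" "A \<subseteq> S" "\<And>s. f s \<in> carrier R" "{s. f s \<noteq> \<zero>} \<subseteq> A" for A f
    using that
  proof (induction A arbitrary: f)
    case empty
    then have "f = \<zero>\<^bsub>free_module R S\<^esub>" by (auto simp: free_module_def)
    then show ?case using L by (metis submodule.axioms(1) subgroup.one_closed monoid.select_convs(2))
  next
    case (insert s A)
    define g where "g = f(s := \<zero>)"
    have "g \<in> L" by (rule insert.IH) (use insert.prems in \<open>auto simp: g_def\<close>)
    moreover have "f s \<odot>\<^bsub>free_module R S\<^esub> free_gen R s \<in> L"
      using F.submoduleE(4)[OF L] gen insert.prems by (auto simp: subset_iff image_iff)
    ultimately have "f s \<odot>\<^bsub>free_module R S\<^esub> free_gen R s \<oplus>\<^bsub>free_module R S\<^esub> g \<in> L"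
      using F.submoduleE(5)[OF L] by blast
    moreover have "f s \<odot>\<^bsub>free_module R S\<^esub> free_gen R s \<oplus>\<^bsub>free_module R S\<^esub> g = f"
      using insert.prems by (auto simp: fun_eq_iff free_module_def free_gen_def g_def subset_iff image_iff)
    ultimately show ?case by simp
  qed
  from this[of "{s. f s \<noteq> \<zero>}" f] show ?thesis using f by (auto simp: free_module_def)
qed

lemma (in module) free_module_lift:
  assumes b: "\<And>s. s \<in> S \<Longrightarrow> b s \<in> carrier M"
  shows "\<exists>g \<in> module_hom R (free_module R S) M. \<forall>s \<in> S. g (free_gen R s) = b s"
proof -
  define g where "g f = (\<Oplus>\<^bsub>M\<^esub>s \<in> {s. f s \<noteq> \<zero>}. f s \<odot>\<^bsub>M\<^esub> b s)" for f
  have g: "g f = (\<Oplus>\<^bsub>M\<^esub>s \<in> A. f s \<odot>\<^bsub>M\<^esub> b s)"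
    if "f \<in> carrier (free_module R S)" "finite A" "{s. f s \<noteq> \<zero>} \<subseteq> A" "A \<subseteq> S" for f A
    unfolding g_def
    by (rule M.add.finprod_mono_neutral_cong_left)
      (use that b in \<open>auto simp: free_module_def subset_iff image_iff\<close>)
  have supp: "finite {s. f s \<noteq> \<zero>}" "{s. f s \<noteq> \<zero>} \<subseteq> S" "\<And>s. f s \<in> carrier R"
    if "f \<in> carrier (free_module R S)" for f
    using that by (auto simp: free_module_def)
  interpret F: module R "free_module R S" by (rule R.free_module)
  have "g \<in> module_hom R (free_module R S) M"
  proof (rule module_homI)
    fix f assume f: "f \<in> carrier (free_module R S)"
    show "g f \<in> carrier M"
      unfolding g_def by (rule M.finsum_closed) (use f b in \<open>auto simp: free_module_def subset_iff image_iff\<close>)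
    fix h assume h: "h \<in> carrier (free_module R S)"
    let ?A = "{s. f s \<noteq> \<zero>} \<union> {s. h s \<noteq> \<zero>}"
    have A: "finite ?A" "?A \<subseteq> S" using supp f h by auto
    have "g (f \<oplus>\<^bsub>free_module R S\<^esub> h) = (\<Oplus>\<^bsub>M\<^esub>s \<in> ?A. f s \<odot>\<^bsub>M\<^esub> b s \<oplus>\<^bsub>M\<^esub> h s \<odot>\<^bsub>M\<^esub> b s)"
    proof -
      have "g (f \<oplus>\<^bsub>free_module R S\<^esub> h) = (\<Oplus>\<^bsub>M\<^esub>s \<in> ?A. (f \<oplus>\<^bsub>free_module R S\<^esub> h) s \<odot>\<^bsub>M\<^esub> b s)"
      proof (rule g)
        show "f \<oplus>\<^bsub>free_module R S\<^esub> h \<in> carrier (free_module R S)" using f h by simp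
        show "{s. (f \<oplus>\<^bsub>free_module R S\<^esub> h) s \<noteq> \<zero>} \<subseteq> ?A" by (auto simp: free_module_def)
      qed (use A in auto)
      also have "\<dots> = (\<Oplus>\<^bsub>M\<^esub>s \<in> ?A. f s \<odot>\<^bsub>M\<^esub> b s \<oplus>\<^bsub>M\<^esub> h s \<odot>\<^bsub>M\<^esub> b s)"
        by (rule M.finsum_cong')
          (use A supp(3)[OF f] supp(3)[OF h] b in \<open>auto simp: free_module_def smult_l_distr subset_iff\<close>)
      finally show ?thesis .
    qed
    also have "\<dots> = (\<Oplus>\<^bsub>M\<^esub>s \<in> ?A. f s \<odot>\<^bsub>M\<^esub> b s) \<oplus>\<^bsub>M\<^esub> (\<Oplus>\<^bsub>M\<^esub>s \<in> ?A. h s \<odot>\<^bsub>M\<^esub> b s)"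
      by (rule M.finsum_addf) (use A supp(3)[OF f] supp(3)[OF h] b in \<open>auto simp: subset_iff\<close>)
    also have "\<dots> = g f \<oplus>\<^bsub>M\<^esub> g h"
      using g[OF f A(1) _ A(2)] g[OF h A(1) _ A(2)] by simp
    finally show "g (f \<oplus>\<^bsub>free_module R S\<^esub> h) = g f \<oplus>\<^bsub>M\<^esub> g h" .
  next
    fix a f assume a: "a \<in> carrier R" and f: "f \<in> carrier (free_module R S)"
    let ?A = "{s. f s \<noteq> \<zero>}"
    have A: "finite ?A" "?A \<subseteq> S" using supp f by auto
    have "g (a \<odot>\<^bsub>free_module R S\<^esub> f) = (\<Oplus>\<^bsub>M\<^esub>s \<in> ?A. (a \<odot>\<^bsub>free_module R S\<^esub> f) s \<odot>\<^bsub>M\<^esub> b s)"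
    proof (rule g)
      show "a \<odot>\<^bsub>free_module R S\<^esub> f \<in> carrier (free_module R S)" using a f by simp
      show "{s. (a \<odot>\<^bsub>free_module R S\<^esub> f) s \<noteq> \<zero>} \<subseteq> ?A" using a by (auto simp: free_module_def)
    qed (use A in auto)
    also have "\<dots> = (\<Oplus>\<^bsub>M\<^esub>s \<in> ?A. a \<odot>\<^bsub>M\<^esub> (f s \<odot>\<^bsub>M\<^esub> b s))"
      by (rule M.finsum_cong')
        (use a A supp(3)[OF f] b in \<open>auto simp: free_module_def smult_assoc1 subset_iff\<close>)
    also have "\<dots> = a \<odot>\<^bsub>M\<^esub> g f"
      unfolding g_def
      by (rule finsum_smult_ldistr[symmetric]) (use a A supp(3)[OF f] b in \<open>auto simp: subset_iff\<close>)
    finally show "g (a \<odot>\<^bsub>free_module R S\<^esub> f) = a \<odot>\<^bsub>M\<^esub> g f" .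
  qed
  moreover have "g (free_gen R s) = b s" if s: "s \<in> S" for s
  proof -
    have "g (free_gen R s) = (\<Oplus>\<^bsub>M\<^esub>t \<in> {s}. free_gen R s t \<odot>\<^bsub>M\<^esub> b t)"
      by (rule g) (use s R.free_gen_closed in \<open>auto simp: free_gen_def\<close>)
    also have "\<dots> = b s" using s b by (simp add: free_gen_def)
    finally show ?thesis .
  qed
  ultimately show ?thesis by blast
qed

subsection \<open>Tensor products\<close>

lemma tensor_kernel_facts:
  fixes R (structure)
  assumes M: "module R M" and N: "module R N"
  defines "F \<equiv> free_module R (carrier M \<times> carrier N)"
  shows "submodule (tensor_kernel R M N) R F"
    and "tensor_relations R M N \<subseteq> tensor_kernel R M N"
    and "\<And>L. submodule L R F \<Longrightarrow> tensor_relations R M N \<subseteq> L \<Longrightarrow> tensor_kernel R M N \<subseteq> L"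
proof -
  interpret M: module R M by fact
  interpret N: module R N by fact
  interpret F: module R F unfolding F_def by (rule M.R.free_module)
  have rel: "tensor_relations R M N \<subseteq> carrier F"
    using M.R.free_gen_closed[of _ "carrier M \<times> carrier N", folded F_def]
    by (fastforce simp: tensor_relations_def Let_def F_def[symmetric])
  show "submodule (tensor_kernel R M N) R F"
    "tensor_relations R M N \<subseteq> tensor_kernel R M N"
    "\<And>L. submodule L R F \<Longrightarrow> tensor_relations R M N \<subseteq> L \<Longrightarrow> tensor_kernel R M N \<subseteq> L"
    unfolding tensor_kernel_def F_def[symmetric] by (fact F.generated_submodule[OF rel])+
qed

lemma tensor_module:
  assumes M: "module R M" and N: "module R N"
  shows "module R (tensor R M N)"
  unfolding tensor_def
  by (rule module.quotient_module[OF cring.free_module tensor_kernel_facts(1)[OF M N]])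
    (use M in \<open>simp add: module_def\<close>)

lemma pure_closed:
  assumes M: "module R M" and N: "module R N" and "x \<in> carrier M" "y \<in> carrier N"
  shows "pure R M N x y \<in> carrier (tensor R M N)"
proof -
  interpret M: module R M by fact
  have "free_gen R (x, y) \<in> carrier (free_module R (carrier M \<times> carrier N))"
    by (rule M.R.free_gen_closed) (use assms in simp)
  then show ?thesis
    unfolding tensor_def pure_def
      module.quotient_carrier[OF M.R.free_module tensor_kernel_facts(1)[OF M N]]
    by (rule imageI)
qed

lemma pure_bilinear:
  assumes M: "module R M" and N: "module R N"
  shows "bilinear_map R M N (tensor R M N) (pure R M N)"
proof -
  interpret M: module R M by fact
  interpret N: module R N by fact
  define F where "F = free_module R (carrier M \<times> carrier N)"
  interpret F: module R F unfolding F_def by (rule M.R.free_module)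
  let ?K = "tensor_kernel R M N"
  note K = tensor_kernel_facts[OF M N, folded F_def]
  let ?T = "tensor R M N"
  have T: "?T = quotient_module F ?K" by (simp add: tensor_def F_def)
  interpret T: module R ?T by (rule tensor_module) fact+
  define p where "p = (\<lambda>x. ?K +>\<^bsub>F\<^esub> x)"
  have p: "p \<in> module_hom R F ?T"
    unfolding p_def T by (rule F.quotient_proj_hom[OF K(1)])
  have pure: "pure R M N x y = p (free_gen R (x, y))" for x y
    by (simp add: pure_def p_def F_def)
  have pK: "p z = \<zero>\<^bsub>?T\<^esub>" if "z \<in> ?K" for z
    using F.a_coset_join2[of z ?K] F.submoduleE(1)[OF K(1)] K(1) that
    by (auto simp: p_def T quotient_module_def submodule_def)
  have eq: "p u = p v" if "u \<ominus>\<^bsub>F\<^esub> v \<in> tensor_relations R M N" "u \<in> carrier F" "v \<in> carrier F" for u v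
  proof -
    have "p u \<ominus>\<^bsub>?T\<^esub> p v = \<zero>\<^bsub>?T\<^esub>"
      using F.module_hom_minus(2)[OF T.module_axioms p that(2,3)] pK K(2) that(1) by auto
    then show ?thesis
      using module_homD(1)[OF p] that by (simp add: T.M.a_minus_eq_zero_iff)
  qed
  have d: "free_gen R (x, y) \<in> carrier F" if "x \<in> carrier M" "y \<in> carrier N" for x y
    unfolding F_def by (rule M.R.free_gen_closed) (use that in auto)
  show ?thesis
    unfolding bilinear_map_def pure
  proof (intro conjI ballI module_homI; (simp add: d module_homD(1)[OF p])?)
    fix m x y assume *: "m \<in> carrier M" "x \<in> carrier N" "y \<in> carrier N"
    then have "free_gen R (m, x \<oplus>\<^bsub>N\<^esub> y) \<ominus>\<^bsub>F\<^esub> (free_gen R (m, x) \<oplus>\<^bsub>F\<^esub> free_gen R (m, y)) \<in> tensor_relations R M N"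
      unfolding tensor_relations_def F_def[symmetric] Let_def by blast
    from eq[OF this] show "p (free_gen R (m, x \<oplus>\<^bsub>N\<^esub> y)) = p (free_gen R (m, x)) \<oplus>\<^bsub>?T\<^esub> p (free_gen R (m, y))"
      using * by (simp add: d module_homD[OF p])
  next
    fix m a x assume *: "m \<in> carrier M" "a \<in> carrier R" "x \<in> carrier N"
    then have "free_gen R (m, a \<odot>\<^bsub>N\<^esub> x) \<ominus>\<^bsub>F\<^esub> a \<odot>\<^bsub>F\<^esub> free_gen R (m, x) \<in> tensor_relations R M N"
      unfolding tensor_relations_def F_def[symmetric] Let_def by blast
    from eq[OF this] show "p (free_gen R (m, a \<odot>\<^bsub>N\<^esub> x)) = a \<odot>\<^bsub>?T\<^esub> p (free_gen R (m, x))"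
      using * by (simp add: d module_homD[OF p])
  next
    fix n x y assume *: "n \<in> carrier N" "x \<in> carrier M" "y \<in> carrier M"
    then have "free_gen R (x \<oplus>\<^bsub>M\<^esub> y, n) \<ominus>\<^bsub>F\<^esub> (free_gen R (x, n) \<oplus>\<^bsub>F\<^esub> free_gen R (y, n)) \<in> tensor_relations R M N"
      unfolding tensor_relations_def F_def[symmetric] Let_def by blast
    from eq[OF this] show "p (free_gen R (x \<oplus>\<^bsub>M\<^esub> y, n)) = p (free_gen R (x, n)) \<oplus>\<^bsub>?T\<^esub> p (free_gen R (y, n))"
      using * by (simp add: d module_homD[OF p])
  next
    fix n a x assume *: "n \<in> carrier N" "a \<in> carrier R" "x \<in> carrier M"
    then have "free_gen R (a \<odot>\<^bsub>M\<^esub> x, n) \<ominus>\<^bsub>F\<^esub> a \<odot>\<^bsub>F\<^esub> free_gen R (x, n) \<in> tensor_relations R M N"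
      unfolding tensor_relations_def F_def[symmetric] Let_def by blast
    from eq[OF this] show "p (free_gen R (a \<odot>\<^bsub>M\<^esub> x, n)) = a \<odot>\<^bsub>?T\<^esub> p (free_gen R (x, n))"
      using * by (simp add: d module_homD[OF p])
  qed
qed

lemma tensor_induct:
  assumes M: "module R M" and N: "module R N" and L: "submodule L R (tensor R M N)"
    and pure: "\<And>x y. \<lbrakk>x \<in> carrier M; y \<in> carrier N\<rbrakk> \<Longrightarrow> pure R M N x y \<in> L"
    and t: "t \<in> carrier (tensor R M N)"
  shows "t \<in> L"
proof -
  interpret M: module R M by fact
  define F where "F = free_module R (carrier M \<times> carrier N)"
  interpret F: module R F unfolding F_def by (rule M.R.free_module)
  let ?K = "tensor_kernel R M N"
  note K = tensor_kernel_facts[OF M N, folded F_def]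
  have T: "tensor R M N = quotient_module F ?K" by (simp add: tensor_def F_def)
  interpret T: module R "tensor R M N" by (rule tensor_module) fact+
  note p = F.quotient_proj_hom[OF K(1), folded T]
  have "submodule {f \<in> carrier F. ?K +>\<^bsub>F\<^esub> f \<in> L} R F"
    by (rule F.submoduleI)
      (use T.submoduleE[OF L] L in \<open>auto simp: module_homD[OF p] F.module_hom_minus(1)[OF T.module_axioms p]
        F.module_hom_zero[OF T.module_axioms p] submodule_def dest: subgroup.one_closed\<close>)
  then have "f \<in> {f \<in> carrier F. ?K +>\<^bsub>F\<^esub> f \<in> L}" if "f \<in> carrier F" for f
    unfolding F_def
    by (rule M.R.free_module_induct)
      (use that pure in \<open>auto intro: M.R.free_gen_closed simp: F_def pure_def\<close>)
  then show ?thesis using t by (auto simp: T F.quotient_carrier[OF K(1)])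
qed

lemma tensor_lift_unique:
  assumes M: "module R M" and N: "module R N" and P: "module R P" and b: "bilinear_map R M N P b"
  shows "\<exists>!f. f \<in> module_hom R (tensor R M N) P \<and> f \<in> extensional (carrier (tensor R M N)) \<and>
    (\<forall>x \<in> carrier M. \<forall>y \<in> carrier N. f (pure R M N x y) = b x y)"
proof -
  interpret M: module R M by fact
  interpret N: module R N by fact
  interpret P: module R P by fact
  define F where "F = free_module R (carrier M \<times> carrier N)"
  interpret F: module R F unfolding F_def by (rule M.R.free_module)
  let ?K = "tensor_kernel R M N"
  let ?T = "tensor R M N"
  note K = tensor_kernel_facts[OF M N, folded F_def]
  have T: "?T = quotient_module F ?K" by (simp add: tensor_def F_def)
  interpret T: module R ?T by (rule tensor_module) fact+
  have b1: "b m \<in> module_hom R N P" if "m \<in> carrier M" for m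
    using b that by (simp add: bilinear_map_def)
  have b2: "(\<lambda>m. b m n) \<in> module_hom R M P" if "n \<in> carrier N" for n
    using b that by (simp add: bilinear_map_def)
  have d: "free_gen R (x, y) \<in> carrier F" if "x \<in> carrier M" "y \<in> carrier N" for x y
    unfolding F_def by (rule M.R.free_gen_closed) (use that in auto)
  obtain g where g: "g \<in> module_hom R F P"
    and g_gen: "\<And>x y. \<lbrakk>x \<in> carrier M; y \<in> carrier N\<rbrakk> \<Longrightarrow> g (free_gen R (x, y)) = b x y"
    using P.free_module_lift[of "carrier M \<times> carrier N" "\<lambda>(x, y). b x y"] module_homD(1)[OF b1]
    by (auto simp: F_def)
  have "tensor_relations R M N \<subseteq> {z \<in> carrier F. g z = \<zero>\<^bsub>P\<^esub>}"
    unfolding tensor_relations_def F_def[symmetric] Let_def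
    by (auto simp: d F.module_hom_minus(2)[OF P g] module_homD[OF g] g_gen
        module_homD[OF b1] module_homD[OF b2] P.M.a_minus_eq_zero_iff)
  then have "?K \<subseteq> {z \<in> carrier F. g z = \<zero>\<^bsub>P\<^esub>}"
    by (rule K(3)[OF F.hom_eq_submodule[OF P g F.zero_hom[OF P]]])
  then have ker: "g z = \<zero>\<^bsub>P\<^esub>" if "z \<in> ?K" for z using that by auto
  obtain h where h: "h \<in> module_hom R ?T P" "\<And>x. x \<in> carrier F \<Longrightarrow> h (?K +>\<^bsub>F\<^esub> x) = g x"
    using F.quotient_lift[OF K(1) P g ker] by (auto simp: T)
  have h_pure: "h (pure R M N x y) = b x y" if "x \<in> carrier M" "y \<in> carrier N" for x y
    using h(2)[OF d[OF that]] g_gen[OF that] by (simp add: pure_def F_def)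
  show ?thesis
  proof (rule ex1I[of _ "restrict h (carrier ?T)"])
    show "restrict h (carrier ?T) \<in> module_hom R ?T P \<and>
      restrict h (carrier ?T) \<in> extensional (carrier ?T) \<and>
      (\<forall>x \<in> carrier M. \<forall>y \<in> carrier N. restrict h (carrier ?T) (pure R M N x y) = b x y)"
      using h(1) h_pure pure_closed[OF M N] by (auto simp: module_hom_def)
  next
    fix f assume f: "f \<in> module_hom R ?T P \<and> f \<in> extensional (carrier ?T) \<and>
      (\<forall>x \<in> carrier M. \<forall>y \<in> carrier N. f (pure R M N x y) = b x y)"
    then have "submodule {t \<in> carrier ?T. f t = h t} R ?T"
      by (intro T.hom_eq_submodule[OF P _ h(1)]) auto
    then have "t \<in> {t \<in> carrier ?T. f t = h t}" if "t \<in> carrier ?T" for t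
      by (rule tensor_induct[OF M N]) (use that f h_pure pure_closed[OF M N] in auto)
    then show "f = restrict h (carrier ?T)"
      using f by (intro extensionalityI[of _ "carrier ?T"]) auto
  qed
qed

lemma tensor_lift:
  assumes "module R M" "module R N" "module R P" "bilinear_map R M N P b"
  shows "tensor_lift R M N P b \<in> module_hom R (tensor R M N) P"
    and "\<lbrakk>x \<in> carrier M; y \<in> carrier N\<rbrakk> \<Longrightarrow> tensor_lift R M N P b (pure R M N x y) = b x y"
  using theI'[OF tensor_lift_unique[OF assms]] by (auto simp: tensor_lift_def)

section \<open>Maps between tensor products\<close>

definition tensor_map ::
    "('k, 'r) ring_scheme \<Rightarrow> ('k, 'm, 'x) module_scheme \<Rightarrow> ('k, 'n, 'y) module_scheme
      \<Rightarrow> ('k, 'p, 'z) module_scheme \<Rightarrow> ('k, 'q, 'w) module_scheme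
      \<Rightarrow> ('m \<Rightarrow> 'p) \<Rightarrow> ('n \<Rightarrow> 'q) \<Rightarrow> ('m \<times> 'n \<Rightarrow> 'k) set \<Rightarrow> ('p \<times> 'q \<Rightarrow> 'k) set"
  where "tensor_map R M N P Q f g =
    tensor_lift R M N (tensor R P Q) (\<lambda>x y. pure R P Q (f x) (g y))"

text \<open>The associator \<open>(M \<otimes> N) \<otimes> P \<rightarrow> M \<otimes> (N \<otimes> P)\<close>.\<close>

definition tensor_assoc ::
    "('k, 'r) ring_scheme \<Rightarrow> ('k, 'm, 'x) module_scheme \<Rightarrow> ('k, 'n, 'y) module_scheme
      \<Rightarrow> ('k, 'p, 'z) module_scheme
      \<Rightarrow> (('m \<times> 'n \<Rightarrow> 'k) set \<times> 'p \<Rightarrow> 'k) set \<Rightarrow> ('m \<times> ('n \<times> 'p \<Rightarrow> 'k) set \<Rightarrow> 'k) set"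
  where "tensor_assoc R M N P =
    (let T = tensor R M (tensor R N P) in
      tensor_lift R (tensor R M N) P T
        (\<lambda>t z. tensor_lift R M N T (\<lambda>x y. pure R M (tensor R N P) x (pure R N P y z)) t))"

section \<open>Algebras, coalgebras, bimodules and bicomodules\<close>

locale assoc_algebra = module R A + ring A for R and A (structure) +
  assumes smult_mult_left:
      "\<lbrakk>a \<in> carrier R; x \<in> carrier A; y \<in> carrier A\<rbrakk> \<Longrightarrow> (a \<odot> x) \<otimes> y = a \<odot> (x \<otimes> y)"
    and smult_mult_right:
      "\<lbrakk>a \<in> carrier R; x \<in> carrier A; y \<in> carrier A\<rbrakk> \<Longrightarrow> x \<otimes> (a \<odot> y) = a \<odot> (x \<otimes> y)"

locale coalgebra = module R C for R and C (structure) +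
  fixes \<Delta> \<epsilon>
  assumes comult_hom: "\<Delta> \<in> module_hom R C (tensor R C C)"
    and counit_hom: "\<epsilon> \<in> module_hom R C (scalar_module R)"
    and coassoc: "c \<in> carrier C \<Longrightarrow>
      tensor_assoc R C C C (tensor_map R C C (tensor R C C) C \<Delta> id (\<Delta> c))
        = tensor_map R C C C (tensor R C C) id \<Delta> (\<Delta> c)"
    and counit_left: "c \<in> carrier C \<Longrightarrow> tensor_lift R C C C (\<lambda>x y. \<epsilon> x \<odot> y) (\<Delta> c) = c"
    and counit_right: "c \<in> carrier C \<Longrightarrow> tensor_lift R C C C (\<lambda>x y. \<epsilon> y \<odot> x) (\<Delta> c) = c"

locale right_comodule = coalgebra R C \<Delta> \<epsilon> + module R M
  for R and C and \<Delta> and \<epsilon> and M (structure) +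
  fixes \<rho>
  assumes right_coact_hom: "\<rho> \<in> module_hom R M (tensor R M C)"
    and right_coact_coassoc: "m \<in> carrier M \<Longrightarrow>
      tensor_assoc R M C C (tensor_map R M C (tensor R M C) C \<rho> id (\<rho> m))
        = tensor_map R M C M (tensor R C C) id \<Delta> (\<rho> m)"
    and right_coact_counit: "m \<in> carrier M \<Longrightarrow>
      tensor_lift R M C M (\<lambda>x c. \<epsilon> c \<odot> x) (\<rho> m) = m"

locale left_comodule = coalgebra R C \<Delta> \<epsilon> + module R M
  for R and C and \<Delta> and \<epsilon> and M (structure) +
  fixes \<gamma>
  assumes left_coact_hom: "\<gamma> \<in> module_hom R M (tensor R C M)"
    and left_coact_coassoc: "m \<in> carrier M \<Longrightarrow>
      tensor_assoc R C C M (tensor_map R C M (tensor R C C) M \<Delta> id (\<gamma> m))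
        = tensor_map R C M C (tensor R C M) id \<gamma> (\<gamma> m)"
    and left_coact_counit: "m \<in> carrier M \<Longrightarrow>
      tensor_lift R C M M (\<lambda>c x. \<epsilon> c \<odot> x) (\<gamma> m) = m"

locale bimodule = assoc_algebra R A + module R M for R and A and M (structure) +
  fixes l r
  assumes left_act_bilinear: "bilinear_map R A M M l"
    and right_act_bilinear: "bilinear_map R M A M r"
    and left_act_one: "m \<in> carrier M \<Longrightarrow> l \<one>\<^bsub>A\<^esub> m = m"
    and right_act_one: "m \<in> carrier M \<Longrightarrow> r m \<one>\<^bsub>A\<^esub> = m"
    and left_act_mult: "\<lbrakk>x \<in> carrier A; y \<in> carrier A; m \<in> carrier M\<rbrakk> \<Longrightarrow>
      l (x \<otimes>\<^bsub>A\<^esub> y) m = l x (l y m)"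
    and right_act_mult: "\<lbrakk>x \<in> carrier A; y \<in> carrier A; m \<in> carrier M\<rbrakk> \<Longrightarrow>
      r m (x \<otimes>\<^bsub>A\<^esub> y) = r (r m x) y"
    and act_comm: "\<lbrakk>x \<in> carrier A; y \<in> carrier A; m \<in> carrier M\<rbrakk> \<Longrightarrow>
      r (l x m) y = l x (r m y)"

locale bicomodule = left_comodule R C \<Delta> \<epsilon> M \<gamma> + right_comodule R C \<Delta> \<epsilon> M \<rho>
  for R and C and \<Delta> and \<epsilon> and M (structure) and \<gamma> and \<rho> +
  assumes coact_comm: "m \<in> carrier M \<Longrightarrow>
    tensor_assoc R C M C (tensor_map R M C (tensor R C M) C \<gamma> id (\<rho> m))
      = tensor_map R C M C (tensor R M C) id \<rho> (\<gamma> m)"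

definition cotensor ::
    "('k, 'r) ring_scheme \<Rightarrow> ('k, 'c, 'x) module_scheme
      \<Rightarrow> ('k, 'm, 'y) module_scheme \<Rightarrow> ('m \<Rightarrow> ('m \<times> 'c \<Rightarrow> 'k) set)
      \<Rightarrow> ('k, 'n, 'z) module_scheme \<Rightarrow> ('n \<Rightarrow> ('c \<times> 'n \<Rightarrow> 'k) set)
      \<Rightarrow> ('m \<times> 'n \<Rightarrow> 'k) set set"
  where "cotensor R C M \<rho> N \<gamma> =
    {t \<in> carrier (tensor R M N).
       tensor_assoc R M C N (tensor_map R M N (tensor R M C) N \<rho> id t)
         = tensor_map R M N M (tensor R C N) id \<gamma> t}"

definition balanced_tensor ::
    "('k, 'r) ring_scheme \<Rightarrow> ('k, 'a, 'x) module_scheme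
      \<Rightarrow> ('k, 'm, 'y) module_scheme \<Rightarrow> ('m \<Rightarrow> 'a \<Rightarrow> 'm)
      \<Rightarrow> ('k, 'n, 'z) module_scheme \<Rightarrow> ('a \<Rightarrow> 'n \<Rightarrow> 'n)
      \<Rightarrow> ('k, ('m \<times> 'n \<Rightarrow> 'k) set set) module"
  where "balanced_tensor R A M r N l =
    quotient_module (tensor R M N)
      (generated_submodule R (tensor R M N)
        {pure R M N (r m y) n \<ominus>\<^bsub>tensor R M N\<^esub> pure R M N m (l y n) | m y n.
           m \<in> carrier M \<and> y \<in> carrier A \<and> n \<in> carrier N})"

section \<open>Weak bialgebras\<close>

text \<open>The product \<open>(a \<otimes> b) (c \<otimes> d) = ac \<otimes> bd\<close> of the algebra \<open>H \<otimes> H\<close>.\<close>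

definition tensor_mult ::
    "('k, 'r) ring_scheme \<Rightarrow> ('k, 'h, 'x) module_scheme
      \<Rightarrow> ('h \<times> 'h \<Rightarrow> 'k) set \<Rightarrow> ('h \<times> 'h \<Rightarrow> 'k) set \<Rightarrow> ('h \<times> 'h \<Rightarrow> 'k) set"
  where "tensor_mult R H X Y =
    tensor_lift R H H (tensor R H H) (\<lambda>a b.
      tensor_lift R H H (tensor R H H) (\<lambda>c d. pure R H H (a \<otimes>\<^bsub>H\<^esub> c) (b \<otimes>\<^bsub>H\<^esub> d)) Y) X"

locale prebialgebra = assoc_algebra R H + coalgebra R H \<Delta> \<epsilon>
  for R and H (structure) and \<Delta> and \<epsilon> +
  assumes comult_mult: "\<lbrakk>h \<in> carrier H; h' \<in> carrier H\<rbrakk> \<Longrightarrow>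
    \<Delta> (h \<otimes> h') = tensor_mult R H (\<Delta> h) (\<Delta> h')"

locale weak_bialgebra = prebialgebra R H \<Delta> \<epsilon> for R and H (structure) and \<Delta> and \<epsilon> +
  assumes left_monoidal:
      "\<lbrakk>h \<in> carrier H; k \<in> carrier H; l \<in> carrier H\<rbrakk> \<Longrightarrow>
      \<epsilon> (h \<otimes> k \<otimes> l) =
        tensor_lift R H H (scalar_module R) (\<lambda>a b. \<epsilon> (h \<otimes> a) \<otimes>\<^bsub>R\<^esub> \<epsilon> (b \<otimes> l)) (\<Delta> k)"
    and right_monoidal:
      "\<lbrakk>h \<in> carrier H; k \<in> carrier H; l \<in> carrier H\<rbrakk> \<Longrightarrow>
      \<epsilon> (h \<otimes> k \<otimes> l) =
        tensor_lift R H H (scalar_module R) (\<lambda>a b. \<epsilon> (h \<otimes> b) \<otimes>\<^bsub>R\<^esub> \<epsilon> (a \<otimes> l)) (\<Delta> k)"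
    and left_comonoidal:
      "tensor_map R H H (tensor R H H) H \<Delta> id (\<Delta> \<one>) =
        tensor_lift R H H (tensor R (tensor R H H) H) (\<lambda>a b.
          tensor_lift R H H (tensor R (tensor R H H) H) (\<lambda>c d.
            pure R (tensor R H H) H (pure R H H a (b \<otimes> c)) d) (\<Delta> \<one>)) (\<Delta> \<one>)"
    and right_comonoidal:
      "tensor_map R H H (tensor R H H) H \<Delta> id (\<Delta> \<one>) =
        tensor_lift R H H (tensor R (tensor R H H) H) (\<lambda>a b.
          tensor_lift R H H (tensor R (tensor R H H) H) (\<lambda>c d.
            pure R (tensor R H H) H (pure R H H a (c \<otimes> b)) d) (\<Delta> \<one>)) (\<Delta> \<one>)"

definition eps_s ::
    "('k, 'r) ring_scheme \<Rightarrow> ('k, 'h, 'x) module_scheme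
      \<Rightarrow> ('h \<Rightarrow> ('h \<times> 'h \<Rightarrow> 'k) set) \<Rightarrow> ('h \<Rightarrow> 'k) \<Rightarrow> 'h \<Rightarrow> 'h"
  where "eps_s R H \<Delta> \<epsilon> h =
    tensor_lift R H H H (\<lambda>a b. \<epsilon> (h \<otimes>\<^bsub>H\<^esub> b) \<odot>\<^bsub>H\<^esub> a) (\<Delta> \<one>\<^bsub>H\<^esub>)"

definition eps_s_bar ::
    "('k, 'r) ring_scheme \<Rightarrow> ('k, 'h, 'x) module_scheme
      \<Rightarrow> ('h \<Rightarrow> ('h \<times> 'h \<Rightarrow> 'k) set) \<Rightarrow> ('h \<Rightarrow> 'k) \<Rightarrow> 'h \<Rightarrow> 'h"
  where "eps_s_bar R H \<Delta> \<epsilon> h =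
    tensor_lift R H H H (\<lambda>a b. \<epsilon> (b \<otimes>\<^bsub>H\<^esub> h) \<odot>\<^bsub>H\<^esub> a) (\<Delta> \<one>\<^bsub>H\<^esub>)"

text \<open>
  \<open>H\<^sub>s\<close> is a module in its own right, so that the coactions below take values in \<open>M \<otimes> H\<^sub>s\<close> and
  \<open>H\<^sub>s \<otimes> M\<close> themselves, not in submodules of \<open>M \<otimes> H\<close> and \<open>H \<otimes> M\<close>.
\<close>

definition source_base ::
    "('k, 'r) ring_scheme \<Rightarrow> ('k, 'h, 'x) module_scheme
      \<Rightarrow> ('h \<Rightarrow> ('h \<times> 'h \<Rightarrow> 'k) set) \<Rightarrow> ('h \<Rightarrow> 'k) \<Rightarrow> ('k, 'h, 'x) module_scheme"
  where "source_base R H \<Delta> \<epsilon> = H\<lparr>carrier := eps_s R H \<Delta> \<epsilon> ` carrier H\<rparr>"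

definition source_comult ::
    "('k, 'r) ring_scheme \<Rightarrow> ('k, 'h, 'x) module_scheme
      \<Rightarrow> ('h \<Rightarrow> ('h \<times> 'h \<Rightarrow> 'k) set) \<Rightarrow> ('h \<Rightarrow> 'k) \<Rightarrow> 'h \<Rightarrow> ('h \<times> 'h \<Rightarrow> 'k) set"
  where "source_comult R H \<Delta> \<epsilon> y =
    (let S = source_base R H \<Delta> \<epsilon>; e = eps_s R H \<Delta> \<epsilon> in
      tensor_lift R H H (tensor R S S) (\<lambda>a b. pure R S S (e a) (e (y \<otimes>\<^bsub>H\<^esub> b))) (\<Delta> \<one>\<^bsub>H\<^esub>))"

definition source_left_act ::
    "('k, 'r) ring_scheme \<Rightarrow> ('k, 'h, 'x) module_scheme \<Rightarrow> ('h \<Rightarrow> 'k)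
      \<Rightarrow> ('k, 'm, 'y) module_scheme \<Rightarrow> ('m \<Rightarrow> ('m \<times> 'h \<Rightarrow> 'k) set) \<Rightarrow> 'h \<Rightarrow> 'm \<Rightarrow> 'm"
  where "source_left_act R H \<epsilon> M \<rho> y m =
    tensor_lift R M H M (\<lambda>x h. \<epsilon> (y \<otimes>\<^bsub>H\<^esub> h) \<odot>\<^bsub>M\<^esub> x) (\<rho> m)"

definition source_right_act ::
    "('k, 'r) ring_scheme \<Rightarrow> ('k, 'h, 'x) module_scheme \<Rightarrow> ('h \<Rightarrow> 'k)
      \<Rightarrow> ('k, 'm, 'y) module_scheme \<Rightarrow> ('m \<Rightarrow> ('m \<times> 'h \<Rightarrow> 'k) set) \<Rightarrow> 'm \<Rightarrow> 'h \<Rightarrow> 'm"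
  where "source_right_act R H \<epsilon> M \<rho> m y =
    tensor_lift R M H M (\<lambda>x h. \<epsilon> (h \<otimes>\<^bsub>H\<^esub> y) \<odot>\<^bsub>M\<^esub> x) (\<rho> m)"

definition source_right_coact ::
    "('k, 'r) ring_scheme \<Rightarrow> ('k, 'h, 'x) module_scheme
      \<Rightarrow> ('h \<Rightarrow> ('h \<times> 'h \<Rightarrow> 'k) set) \<Rightarrow> ('h \<Rightarrow> 'k)
      \<Rightarrow> ('k, 'm, 'y) module_scheme \<Rightarrow> ('m \<Rightarrow> ('m \<times> 'h \<Rightarrow> 'k) set)
      \<Rightarrow> 'm \<Rightarrow> ('m \<times> 'h \<Rightarrow> 'k) set"
  where "source_right_coact R H \<Delta> \<epsilon> M \<rho> m =
    (let S = source_base R H \<Delta> \<epsilon> in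
      tensor_lift R M H (tensor R M S) (\<lambda>x h. pure R M S x (eps_s R H \<Delta> \<epsilon> h)) (\<rho> m))"

definition source_left_coact ::
    "('k, 'r) ring_scheme \<Rightarrow> ('k, 'h, 'x) module_scheme
      \<Rightarrow> ('h \<Rightarrow> ('h \<times> 'h \<Rightarrow> 'k) set) \<Rightarrow> ('h \<Rightarrow> 'k)
      \<Rightarrow> ('k, 'm, 'y) module_scheme \<Rightarrow> ('m \<Rightarrow> ('m \<times> 'h \<Rightarrow> 'k) set)
      \<Rightarrow> 'm \<Rightarrow> ('h \<times> 'm \<Rightarrow> 'k) set"
  where "source_left_coact R H \<Delta> \<epsilon> M \<rho> m =
    (let S = source_base R H \<Delta> \<epsilon> in
      tensor_lift R M H (tensor R S M) (\<lambda>x h. pure R S M (eps_s_bar R H \<Delta> \<epsilon> h) x) (\<rho> m))"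

text \<open>The idempotent \<open>\<pi>\<close> on \<open>M \<otimes> N\<close>, with image \<open>M \<otimes>\<^sup>r N\<close> and coimage \<open>M \<otimes>\<^sub>r N\<close>.\<close>

definition tensor_proj ::
    "('k, 'r) ring_scheme \<Rightarrow> ('k, 'h, 'x) module_scheme \<Rightarrow> ('h \<Rightarrow> 'k)
      \<Rightarrow> ('k, 'm, 'y) module_scheme \<Rightarrow> ('m \<Rightarrow> ('m \<times> 'h \<Rightarrow> 'k) set)
      \<Rightarrow> ('k, 'n, 'z) module_scheme \<Rightarrow> ('n \<Rightarrow> ('n \<times> 'h \<Rightarrow> 'k) set)
      \<Rightarrow> ('m \<times> 'n \<Rightarrow> 'k) set \<Rightarrow> ('m \<times> 'n \<Rightarrow> 'k) set"
  where "tensor_proj R H \<epsilon> M \<rho> N \<sigma> =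
    (let T = tensor R M N in
      tensor_lift R M N T (\<lambda>m n.
        tensor_lift R M H T (\<lambda>x h.
          tensor_lift R N H T (\<lambda>y g. \<epsilon> (h \<otimes>\<^bsub>H\<^esub> g) \<odot>\<^bsub>T\<^esub> pure R M N x y) (\<sigma> n)) (\<rho> m)))"

definition tensor_image ::
    "('k, 'r) ring_scheme \<Rightarrow> ('k, 'h, 'x) module_scheme \<Rightarrow> ('h \<Rightarrow> 'k)
      \<Rightarrow> ('k, 'm, 'y) module_scheme \<Rightarrow> ('m \<Rightarrow> ('m \<times> 'h \<Rightarrow> 'k) set)
      \<Rightarrow> ('k, 'n, 'z) module_scheme \<Rightarrow> ('n \<Rightarrow> ('n \<times> 'h \<Rightarrow> 'k) set)
      \<Rightarrow> ('m \<times> 'n \<Rightarrow> 'k) set set"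
  where "tensor_image R H \<epsilon> M \<rho> N \<sigma> =
    tensor_proj R H \<epsilon> M \<rho> N \<sigma> ` carrier (tensor R M N)"

definition tensor_coimage ::
    "('k, 'r) ring_scheme \<Rightarrow> ('k, 'h, 'x) module_scheme \<Rightarrow> ('h \<Rightarrow> 'k)
      \<Rightarrow> ('k, 'm, 'y) module_scheme \<Rightarrow> ('m \<Rightarrow> ('m \<times> 'h \<Rightarrow> 'k) set)
      \<Rightarrow> ('k, 'n, 'z) module_scheme \<Rightarrow> ('n \<Rightarrow> ('n \<times> 'h \<Rightarrow> 'k) set)
      \<Rightarrow> ('k, ('m \<times> 'n \<Rightarrow> 'k) set set) module"
  where "tensor_coimage R H \<epsilon> M \<rho> N \<sigma> =
    quotient_module (tensor R M N)
      (a_kernel (tensor R M N) (tensor R M N) (tensor_proj R H \<epsilon> M \<rho> N \<sigma>))"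

end

theory Submission
  imports Defs
begin

text \<open>
  The base \<open>H\<^sub>s\<close> consists of the elements \<open>y = \<phi>(1\<^sub>(\<^sub>2\<^sub>)) 1\<^sub>(\<^sub>1\<^sub>)\<close> with \<open>\<phi>\<close> a linear form on \<open>H\<close>, and weak
  comultiplicativity of the unit says that \<open>\<Delta>(y) = 1\<^sub>(\<^sub>1\<^sub>) \<otimes> y1\<^sub>(\<^sub>2\<^sub>) = 1\<^sub>(\<^sub>1\<^sub>) \<otimes> 1\<^sub>(\<^sub>2\<^sub>)y\<close> for such \<open>y\<close>
  (\<open>comult_source\<close>). As \<open>\<Delta>\<close> is multiplicative, \<open>\<Delta>(hy) = h\<^sub>(\<^sub>1\<^sub>) \<otimes> h\<^sub>(\<^sub>2\<^sub>)y\<close> and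
  \<open>\<Delta>(yh) = h\<^sub>(\<^sub>1\<^sub>) \<otimes> yh\<^sub>(\<^sub>2\<^sub>)\<close>, whence \<open>hy = \<epsilon>(h\<^sub>(\<^sub>2\<^sub>)y) h\<^sub>(\<^sub>1\<^sub>)\<close> and \<open>yh = \<epsilon>(yh\<^sub>(\<^sub>2\<^sub>)) h\<^sub>(\<^sub>1\<^sub>)\<close>. On a comodule \<open>M\<close> this gives
  \<open>\<rho>(y \<triangleright> m) = m\<^sub>[\<^sub>0\<^sub>] \<otimes> ym\<^sub>[\<^sub>1\<^sub>]\<close> and \<open>\<rho>(m \<triangleleft> y) = m\<^sub>[\<^sub>0\<^sub>] \<otimes> m\<^sub>[\<^sub>1\<^sub>]y\<close> (\<open>coact_act\<close>), and with these formulas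
  the bimodule axioms reduce to associativity of the product of \<open>H\<close>.

  Write \<open>\<epsilon>\<^sub>s'\<close> for the map \<open>h \<mapsto> \<epsilon>(1\<^sub>(\<^sub>2\<^sub>)h) 1\<^sub>(\<^sub>1\<^sub>)\<close>. The coalgebra side rests on the two formulas
  \<open>\<epsilon>\<^sub>s(h\<^sub>(\<^sub>1\<^sub>)) \<otimes> h\<^sub>(\<^sub>2\<^sub>) = 1\<^sub>(\<^sub>1\<^sub>) \<otimes> h1\<^sub>(\<^sub>2\<^sub>)\<close> and \<open>\<epsilon>\<^sub>s'(h\<^sub>(\<^sub>1\<^sub>)) \<otimes> h\<^sub>(\<^sub>2\<^sub>) = 1\<^sub>(\<^sub>1\<^sub>) \<otimes> 1\<^sub>(\<^sub>2\<^sub>)h\<close> (\<open>comult_eps_s\<close>,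
  \<open>comult_eps_s_bar\<close>). They show that \<open>\<epsilon>\<^sub>s : H \<rightarrow> H\<^sub>s\<close> respects comultiplication, that \<open>\<epsilon>\<^sub>s'\<close> reverses
  it, and that \<open>\<epsilon>\<^sub>s'(h\<^sub>(\<^sub>1\<^sub>)) \<otimes> \<epsilon>\<^sub>s(h\<^sub>(\<^sub>2\<^sub>)) = \<epsilon>\<^sub>s'(h\<^sub>(\<^sub>2\<^sub>)) \<otimes> \<epsilon>\<^sub>s(h\<^sub>(\<^sub>1\<^sub>))\<close>. Pushing the \<open>H\<close>-coaction of \<open>M\<close> forward
  along the two maps therefore yields commuting right and left \<open>H\<^sub>s\<close>-coactions.

  The same formulas give \<open>\<epsilon>(h\<^sub>(\<^sub>2\<^sub>)g) \<epsilon>\<^sub>s(h\<^sub>(\<^sub>1\<^sub>)) = \<epsilon>(hg\<^sub>(\<^sub>2\<^sub>)) \<epsilon>\<^sub>s'(g\<^sub>(\<^sub>1\<^sub>))\<close> (\<open>eps_s_exchange\<close>), since both sides are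
  \<open>\<epsilon>(h1\<^sub>(\<^sub>2\<^sub>)g) 1\<^sub>(\<^sub>1\<^sub>)\<close>; this is exactly what puts the image of \<open>\<pi>\<close> inside the cotensor product. Conversely,
  let \<open>t\<close> be in the cotensor product and let the middle factor \<open>H\<^sub>s\<close> in its defining equation act on
  \<open>N\<close>. Weak multiplicativity of the counit around the unit, \<open>\<epsilon>(\<epsilon>\<^sub>s(h)g) = \<epsilon>(hg)\<close>, turns one side
  into \<open>\<pi>(t)\<close>, and \<open>\<epsilon>(\<epsilon>\<^sub>s'(h\<^sub>(\<^sub>2\<^sub>))h\<^sub>(\<^sub>1\<^sub>)) = \<epsilon>(h)\<close> turns the other into \<open>t\<close>; so \<open>t = \<pi>(t)\<close>
  (\<open>cotensor_fixed\<close>).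

  For the quotients, \<open>\<pi>\<close> identifies \<open>m \<triangleleft> y \<otimes> n\<close> with \<open>m \<otimes> y \<triangleright> n\<close> by the formulas for \<open>\<rho>\<close>. Conversely
  every balanced bilinear \<open>B\<close> is unchanged by \<open>\<pi>\<close>, because
  \<open>\<epsilon>(m\<^sub>[\<^sub>1\<^sub>]n\<^sub>[\<^sub>1\<^sub>]) B(m\<^sub>[\<^sub>0\<^sub>], n\<^sub>[\<^sub>0\<^sub>]) = B(m\<^sub>[\<^sub>0\<^sub>], \<epsilon>\<^sub>s(m\<^sub>[\<^sub>1\<^sub>]) \<triangleright> n) = B(m\<^sub>[\<^sub>0\<^sub>] \<triangleleft> \<epsilon>\<^sub>s(m\<^sub>[\<^sub>1\<^sub>]), n) = B(m, n)\<close>, where the last step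
  is \<open>\<epsilon>(h\<^sub>(\<^sub>1\<^sub>)\<epsilon>\<^sub>s(h\<^sub>(\<^sub>2\<^sub>))) = \<epsilon>(h)\<close> (\<open>balanced_proj\<close>). Taking for \<open>B\<close> the projection to the balanced tensor
  product shows that the kernel of \<open>\<pi>\<close> is generated by the balancing relations. The remaining
  isomorphism is the first isomorphism theorem for \<open>\<pi>\<close>.

  Sweedler notation is rendered by nested tensor lifts, and an identity between tensors is stated as the
  equality of their values under an arbitrary bilinear map. An equation between threefold tensors, such as
  coassociativity, becomes an equation between nested lifts of an arbitrary trilinear map
  (\<open>trilinear_transfer\<close>); two lifts over independent tensors may be interchanged (\<open>lift_swap\<close>).
\<close>

section \<open>Linear maps and tensor products\<close>

named_theorems lin "linearity, bilinearity and closedness of iterated tensor lifts"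

lemma scalar_module_simps [simp]:
  "carrier (scalar_module R) = carrier R" "smult (scalar_module R) = mult R"
  "add (scalar_module R) = add R" "zero (scalar_module R) = zero R"
  by (simp_all add: scalar_module_def)

lemma (in cring) scalar_module: "module R (scalar_module R)"
proof (rule moduleI)
  show "abelian_group (scalar_module R)"
    by (rule abelian_groupI) (auto intro: l_neg a_ac exI[of _ "\<ominus> _"] bexI[of _ "\<ominus> _"] simp: a_ac l_neg)
qed (auto simp: l_distr r_distr m_assoc is_cring)

lemmas module_scalar_module = cring.scalar_module

lemma module_smult_closed:
  "\<lbrakk>module R M; a \<in> carrier R; x \<in> carrier M\<rbrakk> \<Longrightarrow> a \<odot>\<^bsub>M\<^esub> x \<in> carrier M"
  by (rule module.smult_closed)

lemma hom_id: "(\<lambda>x. x) \<in> module_hom R M M"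
  by (simp add: module_hom_def)

lemma hom_comp:
  "\<lbrakk>g \<in> module_hom R N P; f \<in> module_hom R M N\<rbrakk> \<Longrightarrow> (\<lambda>x. g (f x)) \<in> module_hom R M P"
  by (auto simp: module_hom_def Pi_iff)

text \<open>
  Rules of this shape decide the linearity of a composite expression in one variable by its outermost
  operation. The bound variable may occur in only one argument of that operation, so at most one
  rule applies and the simplifier needs no search.
\<close>

lemma hom_smult:
  assumes "module R P" "a \<in> carrier R" "f \<in> module_hom R M P"
  shows "(\<lambda>x. a \<odot>\<^bsub>P\<^esub> f x) \<in> module_hom R M P"
proof -
  interpret P: module R P by fact
  show ?thesis
    by (rule module_homI)
      (use assms(2) in \<open>auto simp: module_homD[OF assms(3)] P.smult_r_distr P.smult_assoc1[symmetric] P.R.m_comm\<close>)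
qed

lemma hom_smult_scalar:
  assumes "module R P" "f \<in> module_hom R M (scalar_module R)" "p \<in> carrier P"
  shows "(\<lambda>x. f x \<odot>\<^bsub>P\<^esub> p) \<in> module_hom R M P"
proof -
  interpret P: module R P by fact
  note f = module_homD[OF assms(2), simplified]
  show ?thesis
    by (rule module_homI) (use assms(3) in \<open>auto simp: f P.smult_l_distr P.smult_assoc1\<close>)
qed

lemma hom_add:
  assumes "module R P" "f \<in> module_hom R M P" "g \<in> module_hom R M P"
  shows "(\<lambda>x. f x \<oplus>\<^bsub>P\<^esub> g x) \<in> module_hom R M P"
proof -
  interpret P: module R P by fact
  show ?thesis
    by (rule module_homI)
      (auto simp: module_homD[OF assms(2)] module_homD[OF assms(3)] P.smult_r_distr P.M.a_ac)
qed

lemma bilinear_mapI: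
  assumes "\<And>m. m \<in> carrier M \<Longrightarrow> (\<lambda>n. b m n) \<in> module_hom R N P"
    and "\<And>n. n \<in> carrier N \<Longrightarrow> (\<lambda>m. b m n) \<in> module_hom R M P"
  shows "bilinear_map R M N P b"
  using assms by (simp add: bilinear_map_def)

lemma bilinear_hom:
  assumes "bilinear_map R A B P F"
  shows "\<lbrakk>f \<in> module_hom R M A; b \<in> carrier B\<rbrakk> \<Longrightarrow> (\<lambda>x. F (f x) b) \<in> module_hom R M P"
    and "\<lbrakk>g \<in> module_hom R N B; a \<in> carrier A\<rbrakk> \<Longrightarrow> (\<lambda>x. F a (g x)) \<in> module_hom R N P"
    and "\<lbrakk>a \<in> carrier A; b \<in> carrier B\<rbrakk> \<Longrightarrow> F a b \<in> carrier P"
  using assms by (auto simp: bilinear_map_def Pi_iff module_hom_def)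

lemma bilinear_smult:
  assumes "bilinear_map R A B P F" "s \<in> carrier R" "a \<in> carrier A" "b \<in> carrier B"
  shows "F (s \<odot>\<^bsub>A\<^esub> a) b = s \<odot>\<^bsub>P\<^esub> F a b" and "F a (s \<odot>\<^bsub>B\<^esub> b) = s \<odot>\<^bsub>P\<^esub> F a b"
  using assms by (auto simp: bilinear_map_def module_hom_def)

lemma pure_hom:
  assumes "module R A" "module R B"
  shows "\<lbrakk>f \<in> module_hom R M A; b \<in> carrier B\<rbrakk> \<Longrightarrow> (\<lambda>x. pure R A B (f x) b) \<in> module_hom R M (tensor R A B)"
    and "\<lbrakk>g \<in> module_hom R N B; a \<in> carrier A\<rbrakk> \<Longrightarrow> (\<lambda>x. pure R A B a (g x)) \<in> module_hom R N (tensor R A B)"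
  by (rule bilinear_hom[OF pure_bilinear[OF assms]]; assumption)+

lemma lift_hom:
  assumes "module R A" "module R B" "module R P" "bilinear_map R A B P F" "f \<in> module_hom R M (tensor R A B)"
  shows "(\<lambda>x. tensor_lift R A B P F (f x)) \<in> module_hom R M P"
  by (rule hom_comp[OF tensor_lift(1)]) fact+

lemma lift_closed:
  assumes "module R A" "module R B" "module R P" "bilinear_map R A B P F" "t \<in> carrier (tensor R A B)"
  shows "tensor_lift R A B P F t \<in> carrier P"
  by (rule module_homD(1)[OF tensor_lift(1)]) fact+

text \<open>
  Pure tensors generate; this is the uniqueness half of the universal property, and the source of
  all equations between lifts below.
\<close>

lemma tensor_hom_eq:
  assumes "module R A" "module R B" "module R P"
    and f: "f \<in> module_hom R (tensor R A B) P" "g \<in> module_hom R (tensor R A B) P"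
    and eq: "\<And>a b. \<lbrakk>a \<in> carrier A; b \<in> carrier B\<rbrakk> \<Longrightarrow> f (pure R A B a b) = g (pure R A B a b)"
    and t: "t \<in> carrier (tensor R A B)"
  shows "f t = g t"
proof -
  interpret T: module R "tensor R A B" by (rule tensor_module) fact+
  have "t \<in> {x \<in> carrier (tensor R A B). f x = g x}"
    by (rule tensor_induct[OF assms(1,2) T.hom_eq_submodule[OF assms(3) f]])
      (use eq t pure_closed[OF assms(1,2)] in auto)
  then show ?thesis by simp
qed

text \<open>
  As a congruence rule this allows rewriting below the Sweedler binders with the knowledge that the
  bound variables lie in the carriers.
\<close>

lemma lift_cong:
  assumes "\<And>a b. \<lbrakk>a \<in> carrier A; b \<in> carrier B\<rbrakk> \<Longrightarrow> F a b = G a b" "t = u"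
  shows "tensor_lift R A B P F t = tensor_lift R A B P G u"
  unfolding tensor_lift_def assms(2) using assms(1) by (metis (no_types, lifting))

declare lift_cong [cong]

lemma lift_push:
  assumes "module R A" "module R B" "module R P" "module R Q" "bilinear_map R A B P F"
    and f: "f \<in> module_hom R P Q" and t: "t \<in> carrier (tensor R A B)"
  shows "f (tensor_lift R A B P F t) = tensor_lift R A B Q (\<lambda>a b. f (F a b)) t"
proof -
  have b: "bilinear_map R A B Q (\<lambda>a b. f (F a b))"
    by (rule bilinear_mapI; rule hom_comp[OF f]; insert assms(5); simp add: bilinear_map_def)
  show ?thesis
    by (rule tensor_hom_eq[OF assms(1,2,4) hom_comp[OF f tensor_lift(1)] tensor_lift(1) _ t])
      (use assms b in \<open>simp_all add: tensor_lift\<close>)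
qed

lemma lift_add:
  assumes M: "module R A" "module R B" "module R P" and F: "bilinear_map R A B P F" "bilinear_map R A B P G"
    and t: "t \<in> carrier (tensor R A B)"
  shows "tensor_lift R A B P (\<lambda>a b. F a b \<oplus>\<^bsub>P\<^esub> G a b) t = tensor_lift R A B P F t \<oplus>\<^bsub>P\<^esub> tensor_lift R A B P G t"
proof -
  have b: "bilinear_map R A B P (\<lambda>a b. F a b \<oplus>\<^bsub>P\<^esub> G a b)"
    using F by (auto intro!: bilinear_mapI hom_add M simp: bilinear_map_def)
  show ?thesis
    by (rule tensor_hom_eq[OF M _ _ _ t]) (auto intro!: hom_add tensor_lift(1) M b F simp: tensor_lift M b F)
qed

text \<open>
  Linearity in a parameter of the bilinear map, as opposed to linearity in the tensor. Nested lifts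
  need both.
\<close>

lemma lift_fun_hom:
  assumes M: "module R A" "module R B" "module R P" and t: "t \<in> carrier (tensor R A B)"
    and F: "\<And>x. x \<in> carrier M \<Longrightarrow> bilinear_map R A B P (F x)"
    and lin: "\<And>a b. \<lbrakk>a \<in> carrier A; b \<in> carrier B\<rbrakk> \<Longrightarrow> (\<lambda>x. F x a b) \<in> module_hom R M P"
  shows "(\<lambda>x. tensor_lift R A B P (F x) t) \<in> module_hom R M P"
proof (rule module_homI)
  fix x assume x: "x \<in> carrier M"
  show "tensor_lift R A B P (F x) t \<in> carrier P"
    by (rule lift_closed) (use M t F x in auto)
  { fix y assume y: "y \<in> carrier M"
    have "tensor_lift R A B P (F (x \<oplus>\<^bsub>M\<^esub> y)) t = tensor_lift R A B P (\<lambda>a b. F x a b \<oplus>\<^bsub>P\<^esub> F y a b) t"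
      by (rule lift_cong) (use x y module_homD(2)[OF lin] in auto)
    also have "\<dots> = tensor_lift R A B P (F x) t \<oplus>\<^bsub>P\<^esub> tensor_lift R A B P (F y) t"
      by (rule lift_add) (use M t F x y in auto)
    finally show "tensor_lift R A B P (F (x \<oplus>\<^bsub>M\<^esub> y)) t = \<dots>" . }
  fix s assume s: "s \<in> carrier R"
  have "tensor_lift R A B P (F (s \<odot>\<^bsub>M\<^esub> x)) t = tensor_lift R A B P (\<lambda>a b. s \<odot>\<^bsub>P\<^esub> F x a b) t"
    by (rule lift_cong) (use x s module_homD(3)[OF lin] in auto)
  also have "\<dots> = s \<odot>\<^bsub>P\<^esub> tensor_lift R A B P (F x) t"
    by (rule lift_push[symmetric]) (use M t F x s in \<open>auto intro: hom_smult hom_id\<close>)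
  finally show "tensor_lift R A B P (F (s \<odot>\<^bsub>M\<^esub> x)) t = \<dots>" .
qed

lemmas [lin] = hom_id hom_smult hom_smult_scalar pure_hom lift_hom lift_fun_hom bilinear_mapI
  lift_closed pure_closed module_smult_closed tensor_module module_scalar_module

lemma hom_smult_R [lin]:
  fixes R (structure)
  assumes "cring R" "f \<in> module_hom R M (scalar_module R)" "p \<in> carrier R"
  shows "(\<lambda>x. f x \<otimes> p) \<in> module_hom R M (scalar_module R)" "(\<lambda>x. p \<otimes> f x) \<in> module_hom R M (scalar_module R)"
  using hom_smult_scalar[OF module_scalar_module, of R f M p] hom_smult[OF module_scalar_module, of R p f M] assms by auto

text \<open>
  Sweedler sums over two independent tensors commute: it suffices to compare both sides for pure
  \<open>t\<close>, where each is the inner lift over \<open>u\<close>.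
\<close>

lemma lift_swap:
  assumes M: "module R A" "module R B" "module R C" "module R D" "module R P"
    and t: "t \<in> carrier (tensor R A B)" and u: "u \<in> carrier (tensor R C D)"
    and F: "\<And>b c d. \<lbrakk>b \<in> carrier B; c \<in> carrier C; d \<in> carrier D\<rbrakk> \<Longrightarrow> (\<lambda>a. F a b c d) \<in> module_hom R A P"
      "\<And>a c d. \<lbrakk>a \<in> carrier A; c \<in> carrier C; d \<in> carrier D\<rbrakk> \<Longrightarrow> (\<lambda>b. F a b c d) \<in> module_hom R B P"
      "\<And>a b d. \<lbrakk>a \<in> carrier A; b \<in> carrier B; d \<in> carrier D\<rbrakk> \<Longrightarrow> (\<lambda>c. F a b c d) \<in> module_hom R C P"
      "\<And>a b c. \<lbrakk>a \<in> carrier A; b \<in> carrier B; c \<in> carrier C\<rbrakk> \<Longrightarrow> (\<lambda>d. F a b c d) \<in> module_hom R D P"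
  shows "tensor_lift R A B P (\<lambda>a b. tensor_lift R C D P (\<lambda>c d. F a b c d) u) t
       = tensor_lift R C D P (\<lambda>c d. tensor_lift R A B P (\<lambda>a b. F a b c d) t) u"
  by (rule tensor_hom_eq[OF M(1,2,5) _ _ _ t]) (simp_all add: lin M F u t tensor_lift)

lemma lift_pure_id:
  assumes M: "module R A" "module R B" and t: "t \<in> carrier (tensor R A B)"
  shows "tensor_lift R A B (tensor R A B) (pure R A B) t = t"
  by (rule tensor_hom_eq[OF M tensor_module[OF M] _ _ _ t]) (simp_all add: lin M t tensor_lift)

named_theorems push "moving a linear operation inside a tensor lift"

lemma lift_smult [push]:
  assumes "module R A" "module R B" "module R P" "bilinear_map R A B P F" "s \<in> carrier R" "t \<in> carrier (tensor R A B)"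
  shows "tensor_lift R A B P F (s \<odot>\<^bsub>tensor R A B\<^esub> t) = s \<odot>\<^bsub>P\<^esub> tensor_lift R A B P F t"
  by (rule module_homD(3)[OF tensor_lift(1)]) fact+

context
  fixes R (structure) and A B and t and P Q F
  assumes M [simp]: "module R A" "module R B" "module R P" "module R Q" and F [simp]: "bilinear_map R A B P F"
    and t [simp]: "t \<in> carrier (tensor R A B)"
begin

lemma lift_bilinear:
  "bilinear_map R P C Q G \<Longrightarrow> c \<in> carrier C \<Longrightarrow> G (tensor_lift R A B P F t) c = tensor_lift R A B Q (\<lambda>a b. G (F a b) c) t"
  "bilinear_map R D P Q K \<Longrightarrow> d \<in> carrier D \<Longrightarrow> K d (tensor_lift R A B P F t) = tensor_lift R A B Q (\<lambda>a b. K d (F a b)) t"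
  by (rule lift_push[where f = "\<lambda>x. G x c"] lift_push[where f = "K d"];
      simp add: bilinear_hom(1)[OF _ hom_id] bilinear_hom(2)[OF _ hom_id])+

end

text \<open>
  All that is needed to compute with an unknown bilinear map. The premises of \<open>lift_bilinear\<close> are rotated so
  that \<open>bilinear_rules[OF F]\<close> instantiates the same premise in every member.
\<close>

lemmas bilinear_rules = bilinear_hom bilinear_smult lift_bilinear[rotated 6]

lemma smult_bilinear:
  assumes "module R P" shows "bilinear_map R (scalar_module R) P P (smult P)"
  by (rule bilinear_mapI) (use assms in \<open>auto intro: hom_smult_scalar hom_smult hom_id\<close>)

context
  fixes R (structure) and A B and t
  assumes M [simp]: "cring R" "module R A" "module R B"
    and t [simp]: "t \<in> carrier (tensor R A B)"
begin

lemma lift_push_smult [push]: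
  "\<lbrakk>module R Q; bilinear_map R A B Q F; s \<in> carrier R\<rbrakk> \<Longrightarrow>
    s \<odot>\<^bsub>Q\<^esub> tensor_lift R A B Q F t = tensor_lift R A B Q (\<lambda>a b. s \<odot>\<^bsub>Q\<^esub> F a b) t"
  by (rule lift_bilinear(2)[OF _ _ _ _ _ _ smult_bilinear]) (simp_all add: lin)

lemma lift_push_scalar [push]:
  "\<lbrakk>module R Q; bilinear_map R A B (scalar_module R) F; q \<in> carrier Q\<rbrakk> \<Longrightarrow>
    tensor_lift R A B (scalar_module R) F t \<odot>\<^bsub>Q\<^esub> q = tensor_lift R A B Q (\<lambda>a b. F a b \<odot>\<^bsub>Q\<^esub> q) t"
  by (rule lift_bilinear(1)[OF _ _ _ _ _ _ smult_bilinear]) (simp_all add: lin)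

lemma lift_push_mult [push]:
  "\<lbrakk>bilinear_map R A B (scalar_module R) F; q \<in> carrier R\<rbrakk> \<Longrightarrow>
    tensor_lift R A B (scalar_module R) F t \<otimes> q = tensor_lift R A B (scalar_module R) (\<lambda>a b. F a b \<otimes> q) t"
  "\<lbrakk>bilinear_map R A B (scalar_module R) F; q \<in> carrier R\<rbrakk> \<Longrightarrow>
    q \<otimes> tensor_lift R A B (scalar_module R) F t = tensor_lift R A B (scalar_module R) (\<lambda>a b. q \<otimes> F a b) t"
  using lift_push_scalar[of "scalar_module R" F q] lift_push_smult[of "scalar_module R" F q]
  by (simp_all add: lin)

lemma lift_push_pure [push]:
  "\<lbrakk>module R C; module R D; bilinear_map R A B C F; d \<in> carrier D\<rbrakk> \<Longrightarrow>
    pure R C D (tensor_lift R A B C F t) d = tensor_lift R A B (tensor R C D) (\<lambda>a b. pure R C D (F a b) d) t"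
  "\<lbrakk>module R C; module R D; bilinear_map R A B D G; c \<in> carrier C\<rbrakk> \<Longrightarrow>
    pure R C D c (tensor_lift R A B D G t) = tensor_lift R A B (tensor R C D) (\<lambda>a b. pure R C D c (G a b)) t"
  by (rule lift_bilinear(1)[OF _ _ _ _ _ _ pure_bilinear] lift_bilinear(2)[OF _ _ _ _ _ _ pure_bilinear]; simp add: lin)+

lemma lift_push_lift [push]:
  "\<lbrakk>module R C; module R D; module R P; bilinear_map R A B (tensor R C D) F; bilinear_map R C D P G\<rbrakk> \<Longrightarrow>
    tensor_lift R C D P G (tensor_lift R A B (tensor R C D) F t)
      = tensor_lift R A B P (\<lambda>a b. tensor_lift R C D P G (F a b)) t"
  by (rule lift_push[OF _ _ _ _ _ tensor_lift(1)]) (simp_all add: lin)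

end

definition trilinear_map where
  "trilinear_map R A B C P F \<longleftrightarrow>
    (\<forall>b \<in> carrier B. \<forall>c \<in> carrier C. (\<lambda>a. F a b c) \<in> module_hom R A P) \<and>
    (\<forall>a \<in> carrier A. \<forall>c \<in> carrier C. (\<lambda>b. F a b c) \<in> module_hom R B P) \<and>
    (\<forall>a \<in> carrier A. \<forall>b \<in> carrier B. (\<lambda>c. F a b c) \<in> module_hom R C P)"

lemma trilinear_mapI [lin]:
  assumes "\<And>b c. \<lbrakk>b \<in> carrier B; c \<in> carrier C\<rbrakk> \<Longrightarrow> (\<lambda>a. F a b c) \<in> module_hom R A P"
    "\<And>a c. \<lbrakk>a \<in> carrier A; c \<in> carrier C\<rbrakk> \<Longrightarrow> (\<lambda>b. F a b c) \<in> module_hom R B P"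
    "\<And>a b. \<lbrakk>a \<in> carrier A; b \<in> carrier B\<rbrakk> \<Longrightarrow> (\<lambda>c. F a b c) \<in> module_hom R C P"
  shows "trilinear_map R A B C P F"
  using assms by (simp add: trilinear_map_def)

lemma trilinear_hom:
  assumes "trilinear_map R A B C P F"
  shows "\<lbrakk>f \<in> module_hom R M A; b \<in> carrier B; c \<in> carrier C\<rbrakk> \<Longrightarrow> (\<lambda>x. F (f x) b c) \<in> module_hom R M P"
    and "\<lbrakk>g \<in> module_hom R N B; a \<in> carrier A; c \<in> carrier C\<rbrakk> \<Longrightarrow> (\<lambda>x. F a (g x) c) \<in> module_hom R N P"
    and "\<lbrakk>h \<in> module_hom R L C; a \<in> carrier A; b \<in> carrier B\<rbrakk> \<Longrightarrow> (\<lambda>x. F a b (h x)) \<in> module_hom R L P"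
    and "\<lbrakk>a \<in> carrier A; b \<in> carrier B; c \<in> carrier C\<rbrakk> \<Longrightarrow> F a b c \<in> carrier P"
  using assms by (auto simp: trilinear_map_def Pi_iff module_hom_def)

lemma tensor_assoc_map_left:
  assumes M [simp]: "cring R" "module R A" "module R B" "module R C" "module R X"
    and f: "f \<in> module_hom R X (tensor R A B)" and t: "t \<in> carrier (tensor R X C)"
  shows "tensor_assoc R A B C (tensor_map R X C (tensor R A B) C f id t)
    = tensor_lift R X C (tensor R A (tensor R B C)) (\<lambda>x c.
        tensor_lift R A B (tensor R A (tensor R B C)) (\<lambda>a b. pure R A (tensor R B C) a (pure R B C b c)) (f x)) t"
  unfolding tensor_assoc_def tensor_map_def Let_def
  by (simp add: push lin t hom_comp[OF f] module_homD(1)[OF f] tensor_lift)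

lemma tensor_map_right:
  assumes M [simp]: "cring R" "module R A" "module R B" "module R C" "module R Y"
    and g: "g \<in> module_hom R Y (tensor R B C)" and t: "t \<in> carrier (tensor R A Y)"
  shows "tensor_map R A Y A (tensor R B C) id g t
    = tensor_lift R A Y (tensor R A (tensor R B C)) (\<lambda>a y.
        tensor_lift R B C (tensor R A (tensor R B C)) (\<lambda>b c. pure R A (tensor R B C) a (pure R B C b c)) (g y)) t"
  unfolding tensor_map_def
  by (simp add: lin module_homD(1)[OF g] lift_push_pure(2)[symmetric] lift_pure_id)

text \<open>
  An equation in \<open>A \<otimes> (B \<otimes> C)\<close> in the form in which coassociativity, the comodule axioms and the cotensor
  product are stated may be evaluated on any trilinear map, that is, on the linear map that it
  induces on \<open>A \<otimes> (B \<otimes> C)\<close>.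
\<close>

lemma trilinear_transfer:
  assumes M [simp]: "cring R" "module R A" "module R B" "module R C" "module R X" "module R Y" "module R P"
    and f: "f \<in> module_hom R X (tensor R A B)" and t [simp]: "t \<in> carrier (tensor R X C)"
    and g: "g \<in> module_hom R Y (tensor R B C)" and u [simp]: "u \<in> carrier (tensor R A Y)"
    and F: "trilinear_map R A B C P F"
    and eq: "tensor_assoc R A B C (tensor_map R X C (tensor R A B) C f id t) = tensor_map R A Y A (tensor R B C) id g u"
  shows "tensor_lift R X C P (\<lambda>x c. tensor_lift R A B P (\<lambda>a b. F a b c) (f x)) t
       = tensor_lift R A Y P (\<lambda>a y. tensor_lift R B C P (\<lambda>b c. F a b c) (g y)) u"
proof -
  let ?\<Phi> = "tensor_lift R A (tensor R B C) P (\<lambda>a s. tensor_lift R B C P (\<lambda>b c. F a b c) s)"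
  note [simp] = lin trilinear_hom[OF F] hom_comp[OF f] module_homD(1)[OF f] hom_comp[OF g] module_homD(1)[OF g]
  have "?\<Phi> (tensor_assoc R A B C (tensor_map R X C (tensor R A B) C f id t)) = ?\<Phi> (tensor_map R A Y A (tensor R B C) id g u)"
    by (simp only: eq)
  then show ?thesis
    by (simp add: tensor_assoc_map_left tensor_map_right f g push tensor_lift)
qed

text \<open>
  From here on the side conditions of the rules for lifts are discharged by plain simplification.
\<close>

declare lin [simp]

lemma (in module) hom_image_submodule:
  assumes N: "module R N" and f: "f \<in> module_hom R M N"
  shows "submodule (f ` carrier M) R N"
proof -
  interpret N: module R N by fact
  note h = module_homD[OF f] module_hom_minus(1)[OF N f] module_hom_zero[OF N f]
  show ?thesis
  proof (rule N.submoduleI)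
    show "\<zero>\<^bsub>N\<^esub> \<in> f ` carrier M" by (rule image_eqI[of _ _ "\<zero>\<^bsub>M\<^esub>"]) (simp_all add: h)
    show "f ` carrier M \<subseteq> carrier N" by (auto simp: h)
    show "\<ominus>\<^bsub>N\<^esub> a \<in> f ` carrier M" if "a \<in> f ` carrier M" for a
      using that by (auto simp flip: h(4))
    show "a \<oplus>\<^bsub>N\<^esub> b \<in> f ` carrier M" if "a \<in> f ` carrier M" "b \<in> f ` carrier M" for a b
      using that by (auto simp flip: h(2))
    show "s \<odot>\<^bsub>N\<^esub> b \<in> f ` carrier M" if "s \<in> carrier R" "b \<in> f ` carrier M" for s b
      using that by (auto simp flip: h(3))
  qed
qed

lemma (in module) submodule_abelian_subgroup:
  assumes L: "submodule L R M"
  shows "abelian_subgroup L M"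
  by (rule abelian_subgroupI3[OF additive_subgroupI[OF submodule.axioms(1)[OF L]] M.abelian_group_axioms])

lemma (in module) first_isomorphism:
  assumes N: "module R N" and f: "f \<in> module_hom R M N"
  shows "(\<lambda>X. the_elem (f ` X)) \<in> module_iso R (quotient_module M (a_kernel M N f)) (N\<lparr>carrier := f ` carrier M\<rparr>)"
proof -
  interpret N: module R N by fact
  let ?K = "a_kernel M N f"
  have K: "?K = {x \<in> carrier M. f x = \<zero>\<^bsub>N\<^esub>}" by (auto simp: a_kernel_def')
  have sub: "submodule ?K R M" unfolding K by (rule hom_eq_submodule[OF N f zero_hom[OF N]])
  interpret K: abelian_subgroup ?K M
    by (rule submodule_abelian_subgroup[OF sub])
  note h = module_homD[OF f]
  have coset: "f y = f x" if "x \<in> carrier M" "y \<in> ?K +>\<^bsub>M\<^esub> x" for x y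
  proof -
    obtain l where "l \<in> carrier M" "f l = \<zero>\<^bsub>N\<^esub>" "y = l \<oplus>\<^bsub>M\<^esub> x"
      using \<open>y \<in> _\<close> unfolding a_r_coset_def' K by blast
    then show ?thesis using that(1) by (simp add: h(1,2))
  qed
  have the: "the_elem (f ` (?K +>\<^bsub>M\<^esub> x)) = f x" if "x \<in> carrier M" for x
  proof -
    have "f ` (?K +>\<^bsub>M\<^esub> x) = {f x}" using coset[OF that] K.a_rcos_self[OF that] by blast
    then show ?thesis by simp
  qed
  note q = quotient_carrier[OF sub] quotient_add[OF sub] quotient_smult[OF sub]
  have eq: "?K +>\<^bsub>M\<^esub> x = ?K +>\<^bsub>M\<^esub> y" if xy: "x \<in> carrier M" "y \<in> carrier M" "f x = f y" for x y
  proof -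
    have "f (x \<ominus>\<^bsub>M\<^esub> y) = \<zero>\<^bsub>N\<^esub>"
      using xy h(1) by (simp only: module_hom_minus(2)[OF N f] N.M.a_minus_eq_zero_iff)
    then have "x \<ominus>\<^bsub>M\<^esub> y \<in> ?K" unfolding K using xy(1,2) by blast
    then have "x \<in> ?K +>\<^bsub>M\<^esub> y" using xy(1,2) K.a_rcos_module[of y x] by (simp only: M.minus_eq)
    then show ?thesis using M.a_repr_independence[OF _ xy(2) K.a_subgroup] by simp
  qed
  have inj: "inj_on (\<lambda>X. the_elem (f ` X)) (carrier (quotient_module M ?K))"
    unfolding q(1) by (rule inj_onI; elim imageE; simp only: the; rule eq)
  have "(\<lambda>X. the_elem (f ` X)) \<in> module_hom R (quotient_module M ?K) (N\<lparr>carrier := f ` carrier M\<rparr>)"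
    by (rule module_homI; unfold q(1); elim imageE; simp add: q(2,3) the h(2,3))
  moreover have "(\<lambda>X. the_elem (f ` X)) ` carrier (quotient_module M ?K) = f ` carrier M"
    unfolding q(1) image_image by (rule image_cong[OF refl]) (rule the)
  ultimately show ?thesis
    using inj by (simp add: module_iso_def bij_betw_def)
qed

section \<open>The source base of a weak bialgebra\<close>

lemma assoc_algebra_mult_bilinear:
  assumes "assoc_algebra R A"
  shows "bilinear_map R A A A (mult A)"
proof -
  interpret assoc_algebra R A by fact
  show ?thesis
    by (rule bilinear_mapI; rule module_homI) (auto simp: l_distr r_distr smult_mult_left smult_mult_right)
qed

context weak_bialgebra
begin

abbreviation sweedler where "sweedler P F h \<equiv> tensor_lift R H H P F (\<Delta> h)"

lemma carrier_modules [simp]: "module R H" "cring R"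
  using module_axioms by (auto simp: module_def)

lemma structure_closed [simp]:
  "x \<in> carrier H \<Longrightarrow> \<epsilon> x \<in> carrier R"
  "x \<in> carrier H \<Longrightarrow> \<Delta> x \<in> carrier (tensor R H H)"
  using module_homD(1)[OF counit_hom] module_homD(1)[OF comult_hom] by simp_all

lemma structure_hom [simp]:
  "f \<in> module_hom R M H \<Longrightarrow> (\<lambda>x. \<epsilon> (f x)) \<in> module_hom R M (scalar_module R)"
  "f \<in> module_hom R M H \<Longrightarrow> (\<lambda>x. \<Delta> (f x)) \<in> module_hom R M (tensor R H H)"
  by (rule hom_comp[OF counit_hom] hom_comp[OF comult_hom]; assumption)+

lemma mult_bilinear: "bilinear_map R H H H (\<otimes>)"
  by (rule assoc_algebra_mult_bilinear) unfold_locales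

lemmas mult_hom [simp] = bilinear_hom(1,2)[OF mult_bilinear]

lemma structure_smult [simp]:
  "\<lbrakk>s \<in> carrier R; x \<in> carrier H\<rbrakk> \<Longrightarrow> \<epsilon> (s \<odot> x) = s \<otimes>\<^bsub>R\<^esub> \<epsilon> x"
  "\<lbrakk>s \<in> carrier R; x \<in> carrier H\<rbrakk> \<Longrightarrow> \<Delta> (s \<odot> x) = s \<odot>\<^bsub>tensor R H H\<^esub> \<Delta> x"
  "\<lbrakk>s \<in> carrier R; x \<in> carrier H; y \<in> carrier H\<rbrakk> \<Longrightarrow> (s \<odot> x) \<otimes> y = s \<odot> (x \<otimes> y)"
  "\<lbrakk>s \<in> carrier R; x \<in> carrier H; y \<in> carrier H\<rbrakk> \<Longrightarrow> x \<otimes> (s \<odot> y) = s \<odot> (x \<otimes> y)"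
  using module_homD(3)[OF counit_hom] module_homD(3)[OF comult_hom]
  by (simp_all add: smult_mult_left smult_mult_right)

lemma structure_push [push]:
  assumes "module R A" "module R B" "bilinear_map R A B H F" "t \<in> carrier (tensor R A B)"
  shows "\<epsilon> (tensor_lift R A B H F t) = tensor_lift R A B (scalar_module R) (\<lambda>a b. \<epsilon> (F a b)) t"
    and "\<Delta> (tensor_lift R A B H F t) = tensor_lift R A B (tensor R H H) (\<lambda>a b. \<Delta> (F a b)) t"
    and "h \<in> carrier H \<Longrightarrow> h \<otimes> tensor_lift R A B H F t = tensor_lift R A B H (\<lambda>a b. h \<otimes> F a b) t"
    and "h \<in> carrier H \<Longrightarrow> tensor_lift R A B H F t \<otimes> h = tensor_lift R A B H (\<lambda>a b. F a b \<otimes> h) t"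
  by (rule lift_push lift_push[where f = "\<lambda>x. x \<otimes> h"]; use assms counit_hom comult_hom in simp)+

lemma coassoc_lift:
  assumes "module R P" "h \<in> carrier H" "trilinear_map R H H H P F"
  shows "sweedler P (\<lambda>a c. sweedler P (\<lambda>p q. F p q c) a) h = sweedler P (\<lambda>a c. sweedler P (\<lambda>p q. F a p q) c) h"
  by (rule trilinear_transfer) (use assms coassoc comult_hom in simp_all)

lemma counit_lift:
  assumes "module R P" "h \<in> carrier H" "f \<in> module_hom R H P"
  shows "sweedler P (\<lambda>a b. \<epsilon> a \<odot>\<^bsub>P\<^esub> f b) h = f h" and "sweedler P (\<lambda>a b. \<epsilon> b \<odot>\<^bsub>P\<^esub> f a) h = f h"
proof -
  note f = module_homD[OF assms(3)] hom_comp[OF assms(3)]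
  have "f h = f (sweedler H (\<lambda>a b. \<epsilon> a \<odot> b) h)" by (simp add: counit_left assms)
  also have "\<dots> = sweedler P (\<lambda>a b. f (\<epsilon> a \<odot> b)) h" by (rule lift_push) (use assms in simp_all)
  finally show "sweedler P (\<lambda>a b. \<epsilon> a \<odot>\<^bsub>P\<^esub> f b) h = f h" by (simp add: f)
  have "f h = f (sweedler H (\<lambda>a b. \<epsilon> b \<odot> a) h)" by (simp add: counit_right assms)
  also have "\<dots> = sweedler P (\<lambda>a b. f (\<epsilon> b \<odot> a)) h" by (rule lift_push) (use assms in simp_all)
  finally show "sweedler P (\<lambda>a b. \<epsilon> b \<odot>\<^bsub>P\<^esub> f a) h = f h" by (simp add: f)
qed

lemma comult_mult_lift:
  assumes "module R P" "h \<in> carrier H" "k \<in> carrier H" "bilinear_map R H H P F"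
  shows "sweedler P F (h \<otimes> k) = sweedler P (\<lambda>a b. sweedler P (\<lambda>c d. F (a \<otimes> c) (b \<otimes> d)) k) h"
  unfolding comult_mult[OF assms(2,3)] tensor_mult_def
  by (simp add: assms push tensor_lift bilinear_hom[OF assms(4)])

text \<open>
  The two comonoidality axioms, evaluated on a trilinear map like coassociativity. They are stated in
  \<open>(H \<otimes> H) \<otimes> H\<close>, so the map that evaluates them is built from the other bracketing.
\<close>

lemma left_comonoidal_lift:
  assumes P: "module R P" and F: "trilinear_map R H H H P F"
  shows "sweedler P (\<lambda>a c. sweedler P (\<lambda>p q. F p q c) a) \<one> = sweedler P (\<lambda>a b. sweedler P (\<lambda>c d. F a (b \<otimes> c) d) \<one>) \<one>"
proof -
  note [simp] = P trilinear_hom[OF F]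
  let ?\<Phi> = "tensor_lift R (tensor R H H) H P (\<lambda>s c. tensor_lift R H H P (\<lambda>a b. F a b c) s)"
  from arg_cong[OF left_comonoidal, of ?\<Phi>] show ?thesis
    by (simp add: push tensor_lift tensor_map_def)
qed

lemma right_comonoidal_lift:
  assumes P: "module R P" and F: "trilinear_map R H H H P F"
  shows "sweedler P (\<lambda>a c. sweedler P (\<lambda>p q. F p q c) a) \<one> = sweedler P (\<lambda>a b. sweedler P (\<lambda>c d. F a (c \<otimes> b) d) \<one>) \<one>"
proof -
  note [simp] = P trilinear_hom[OF F]
  let ?\<Phi> = "tensor_lift R (tensor R H H) H P (\<lambda>s c. tensor_lift R H H P (\<lambda>a b. F a b c) s)"
  from arg_cong[OF right_comonoidal, of ?\<Phi>] show ?thesis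
    by (simp add: push tensor_lift tensor_map_def)
qed

abbreviation "\<epsilon>\<^sub>s \<equiv> eps_s R H \<Delta> \<epsilon>"
abbreviation "\<epsilon>\<^sub>s' \<equiv> eps_s_bar R H \<Delta> \<epsilon>"

lemma eps_s_sweedler:
  "\<epsilon>\<^sub>s h = sweedler H (\<lambda>a b. \<epsilon> (h \<otimes> b) \<odot> a) \<one>" "\<epsilon>\<^sub>s' h = sweedler H (\<lambda>a b. \<epsilon> (b \<otimes> h) \<odot> a) \<one>"
  by (simp_all add: eps_s_def eps_s_bar_def)

lemma eps_s_hom [simp]:
  "f \<in> module_hom R M H \<Longrightarrow> (\<lambda>x. \<epsilon>\<^sub>s (f x)) \<in> module_hom R M H"
  "f \<in> module_hom R M H \<Longrightarrow> (\<lambda>x. \<epsilon>\<^sub>s' (f x)) \<in> module_hom R M H"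
  by (simp_all add: eps_s_sweedler hom_comp module_homD)

lemma eps_s_closed [simp]: "h \<in> carrier H \<Longrightarrow> \<epsilon>\<^sub>s h \<in> carrier H" "h \<in> carrier H \<Longrightarrow> \<epsilon>\<^sub>s' h \<in> carrier H"
  by (simp_all add: eps_s_sweedler)

lemma scalar_mult_closed [simp]: "a \<in> carrier R \<Longrightarrow> b \<in> carrier R \<Longrightarrow> a \<otimes>\<^bsub>R\<^esub> b \<in> carrier R"
  by (meson carrier_modules(2) cring.cring_simprules(5))

text \<open>
  The key property of the elements of \<open>H\<^sub>s\<close>. By linearity, \<open>\<Delta>(y)\<close> is the image of the double coproduct of
  \<open>\<one>\<close> under \<open>\<phi>\<close> applied to the third factor; the left and right comonoidality axioms compute it in two ways.
\<close>

lemma source_element_comult: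
  assumes P [simp]: "module R P" and F: "bilinear_map R H H P F"
    and \<phi>: "\<phi> \<in> module_hom R H (scalar_module R)" and y: "y = sweedler H (\<lambda>a b. \<phi> b \<odot> a) \<one>"
  shows "sweedler P F y = sweedler P (\<lambda>a b. F a (b \<otimes> y)) \<one>"
    and "sweedler P F y = sweedler P (\<lambda>a b. F a (y \<otimes> b)) \<one>"
proof -
  note [simp] = bilinear_rules[OF F] hom_comp[OF \<phi>] module_homD(1)[OF \<phi>, simplified]
  have y_lift: "sweedler P F y = sweedler P (\<lambda>a b. sweedler P (\<lambda>p q. \<phi> b \<odot>\<^bsub>P\<^esub> F p q) a) \<one>"
    by (simp add: y push)
  note comonoidal = left_comonoidal_lift[of P "\<lambda>p q b. \<phi> b \<odot>\<^bsub>P\<^esub> F p q", simplified]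
    right_comonoidal_lift[of P "\<lambda>p q b. \<phi> b \<odot>\<^bsub>P\<^esub> F p q", simplified]
  from comonoidal[folded y_lift] show "sweedler P F y = sweedler P (\<lambda>a b. F a (b \<otimes> y)) \<one>"
    "sweedler P F y = sweedler P (\<lambda>a b. F a (y \<otimes> b)) \<one>"
    by (simp_all add: y push)
qed

abbreviation "H\<^sub>s \<equiv> source_base R H \<Delta> \<epsilon>"

lemma source_base_fields [simp]:
  "mult H\<^sub>s = mult H" "one H\<^sub>s = one H" "add H\<^sub>s = add H" "zero H\<^sub>s = zero H"
  by (simp_all add: source_base_def)

text \<open>
  Not a simplification rule: the linearity rules recognize a scalar multiplication with values in \<open>H\<^sub>s\<close> by its
  being that of \<open>H\<^sub>s\<close>.
\<close>

lemma source_smult: "smult H\<^sub>s = smult H"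
  by (simp add: source_base_def)

lemma source_carrier: "carrier H\<^sub>s = \<epsilon>\<^sub>s ` carrier H"
  by (simp add: source_base_def)

text \<open>
  Both projections are \<open>id \<otimes> \<epsilon>\<close> applied to one of the two formulas for \<open>\<Delta>(y)\<close>, so the
  counit axiom returns \<open>y\<close>. In particular \<open>\<epsilon>\<^sub>s\<close> and \<open>\<epsilon>\<^sub>s'\<close> have the same image.
\<close>

lemma source_element_fixed:
  assumes \<phi>: "\<phi> \<in> module_hom R H (scalar_module R)" and y: "y = sweedler H (\<lambda>a b. \<phi> b \<odot> a) \<one>"
  shows "y \<in> carrier H" "\<epsilon>\<^sub>s y = y" "\<epsilon>\<^sub>s' y = y"
proof -
  note [simp] = hom_comp[OF \<phi>] module_homD(1)[OF \<phi>, simplified]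
  show yH: "y \<in> carrier H" by (simp add: y)
  then show "\<epsilon>\<^sub>s y = y" "\<epsilon>\<^sub>s' y = y"
    by (simp_all add: eps_s_sweedler source_element_comult[OF _ _ \<phi> y, of H "\<lambda>a b. \<epsilon> b \<odot> a", symmetric] counit_right)
qed

lemma source_elementI:
  assumes \<phi>: "\<phi> \<in> module_hom R H (scalar_module R)" and y: "y = sweedler H (\<lambda>a b. \<phi> b \<odot> a) \<one>"
  shows "y \<in> carrier H\<^sub>s"
  using source_element_fixed[OF assms] unfolding source_carrier by (metis imageI)

lemma eps_s_source [simp]:
  assumes "h \<in> carrier H" shows "\<epsilon>\<^sub>s h \<in> carrier H\<^sub>s" "\<epsilon>\<^sub>s' h \<in> carrier H\<^sub>s"
  by (rule source_elementI[OF _ eps_s_sweedler(1)] source_elementI[OF _ eps_s_sweedler(2)]; use assms in simp)+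

lemma source_fixed [simp]:
  assumes "y \<in> carrier H\<^sub>s" shows "y \<in> carrier H" "\<epsilon>\<^sub>s y = y" "\<epsilon>\<^sub>s' y = y"
proof -
  obtain k where k: "k \<in> carrier H" "y = \<epsilon>\<^sub>s k" using assms by (auto simp: source_carrier)
  then show "y \<in> carrier H" "\<epsilon>\<^sub>s y = y" "\<epsilon>\<^sub>s' y = y"
    using source_element_fixed[OF _ eps_s_sweedler(1), of k] by simp_all
qed

lemma comult_source:
  assumes "module R P" "bilinear_map R H H P F" "y \<in> carrier H\<^sub>s"
  shows "sweedler P F y = sweedler P (\<lambda>a b. F a (b \<otimes> y)) \<one>"
    and "sweedler P F y = sweedler P (\<lambda>a b. F a (y \<otimes> b)) \<one>"
proof -
  have y: "y \<in> carrier H" "y = sweedler H (\<lambda>a b. \<epsilon> (y \<otimes> b) \<odot> a) \<one>"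
    using assms(3) by (simp_all flip: eps_s_sweedler)
  then have \<phi>: "(\<lambda>b. \<epsilon> (y \<otimes> b)) \<in> module_hom R H (scalar_module R)" by simp
  show "sweedler P F y = sweedler P (\<lambda>a b. F a (b \<otimes> y)) \<one>"
    and "sweedler P F y = sweedler P (\<lambda>a b. F a (y \<otimes> b)) \<one>"
    by (rule source_element_comult[OF assms(1,2) \<phi> y(2)])+
qed

text \<open>
  Expand the coproduct of the product, use the formula for \<open>\<Delta>(y)\<close>, and absorb the coproduct of \<open>\<one>\<close>
  again by multiplicativity.
\<close>

lemma comult_mult_source:
  assumes P [simp]: "module R P" and F: "bilinear_map R H H P F" and y [simp]: "y \<in> carrier H\<^sub>s" and h [simp]: "h \<in> carrier H"
  shows "sweedler P F (h \<otimes> y) = sweedler P (\<lambda>a b. F a (b \<otimes> y)) h"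
    and "sweedler P F (y \<otimes> h) = sweedler P (\<lambda>a b. F a (y \<otimes> b)) h"
proof -
  note [simp] = bilinear_rules[OF F]
  have "sweedler P F (h \<otimes> y) = sweedler P (\<lambda>a b. sweedler P (\<lambda>c d. F (a \<otimes> c) (b \<otimes> (d \<otimes> y))) \<one>) h"
    by (simp add: comult_mult_lift F comult_source(1)[of P _ y])
  also have "\<dots> = sweedler P (\<lambda>a b. F a (b \<otimes> y)) (h \<otimes> \<one>)"
    by (simp add: comult_mult_lift m_assoc del: r_one)
  finally show "sweedler P F (h \<otimes> y) = sweedler P (\<lambda>a b. F a (b \<otimes> y)) h" by simp
  have "sweedler P F (y \<otimes> h) = sweedler P (\<lambda>a b. sweedler P (\<lambda>c d. F (a \<otimes> c) (y \<otimes> b \<otimes> d)) h) \<one>"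
    by (simp add: comult_mult_lift F comult_source(2)[of P _ y])
  also have "\<dots> = sweedler P (\<lambda>a b. F a (y \<otimes> b)) (\<one> \<otimes> h)"
    by (simp add: comult_mult_lift m_assoc del: l_one)
  finally show "sweedler P F (y \<otimes> h) = sweedler P (\<lambda>a b. F a (y \<otimes> b)) h" by simp
qed

lemma mult_source_counit:
  assumes "y \<in> carrier H\<^sub>s" "h \<in> carrier H"
  shows "sweedler H (\<lambda>a b. \<epsilon> (b \<otimes> y) \<odot> a) h = h \<otimes> y" and "sweedler H (\<lambda>a b. \<epsilon> (y \<otimes> b) \<odot> a) h = y \<otimes> h"
  using comult_mult_source[of H "\<lambda>a b. \<epsilon> b \<odot> a" y h] assms by (simp_all add: counit_right)

lemma eps_s_one: "\<epsilon>\<^sub>s \<one> = \<one>"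
  by (simp add: eps_s_sweedler counit_right)

lemma source_one [simp]: "\<one> \<in> carrier H\<^sub>s"
  using eps_s_source(1)[of \<one>] by (simp add: eps_s_one)

lemma source_mult [simp]:
  assumes [simp]: "x \<in> carrier H\<^sub>s" "y \<in> carrier H\<^sub>s"
  shows "x \<otimes> y \<in> carrier H\<^sub>s"
proof -
  \<comment> \<open>Exhibit \<open>xy\<close> as \<open>\<phi>(1\<^sub>(\<^sub>2\<^sub>)) 1\<^sub>(\<^sub>1\<^sub>)\<close> with \<open>\<phi>(b) = \<epsilon>(xyb)\<close>.\<close>
  have "x \<otimes> y = sweedler H (\<lambda>a b. \<epsilon> b \<odot> a) (x \<otimes> y)" by (simp add: counit_right)
  also have "\<dots> = sweedler H (\<lambda>a b. \<epsilon> (x \<otimes> y \<otimes> b) \<odot> a) \<one>"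
    by (simp add: comult_mult_source(2)[of H _ x y] comult_source(2)[of H _ y] m_assoc)
  finally show ?thesis by (rule source_elementI[rotated]) simp
qed

lemma source_module [simp]: "module R H\<^sub>s"
proof -
  have "\<epsilon>\<^sub>s \<in> module_hom R H H" using eps_s_hom(1)[OF hom_id] .
  then have "submodule (\<epsilon>\<^sub>s ` carrier H) R H" by (rule hom_image_submodule[OF carrier_modules(1)])
  from submodule.submodule_is_module[OF this carrier_modules(1)] show ?thesis by (simp only: source_base_def)
qed

lemma source_algebra: "assoc_algebra R H\<^sub>s"
proof -
  interpret S: module R H\<^sub>s by simp
  show ?thesis
    by unfold_locales (auto simp: m_assoc l_distr r_distr source_smult)
qed

text \<open>
  Insert a counit in front of \<open>h1\<^sub>(\<^sub>2\<^sub>)\<close>, expand \<open>\<Delta>(h1\<^sub>(\<^sub>2\<^sub>))\<close> by multiplicativity, and rewrite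
  \<open>1\<^sub>(\<^sub>1\<^sub>) \<otimes> \<Delta>(1\<^sub>(\<^sub>2\<^sub>))\<close> as \<open>1\<^sub>(\<^sub>1\<^sub>) \<otimes> 1\<^sub>(\<^sub>1\<^sub>')1\<^sub>(\<^sub>2\<^sub>) \<otimes> 1\<^sub>(\<^sub>2\<^sub>')\<close>. The second copy of \<open>\<Delta>(\<one>)\<close> is absorbed by \<open>\<Delta>(h)\<close>,
  leaving \<open>\<epsilon>(h\<^sub>(\<^sub>1\<^sub>)1\<^sub>(\<^sub>2\<^sub>)) 1\<^sub>(\<^sub>1\<^sub>) \<otimes> h\<^sub>(\<^sub>2\<^sub>)\<close>.
\<close>

lemma comult_eps_s:
  assumes P [simp]: "module R P" and F: "bilinear_map R H H P F" and h [simp]: "h \<in> carrier H"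
  shows "sweedler P (\<lambda>a b. F (\<epsilon>\<^sub>s a) b) h = sweedler P (\<lambda>a b. F a (h \<otimes> b)) \<one>"
proof -
  note [simp] = bilinear_rules[OF F]
  have "sweedler P (\<lambda>p q. F p (h \<otimes> q)) \<one>
     = sweedler P (\<lambda>p q. sweedler P (\<lambda>c d. \<epsilon> c \<odot>\<^bsub>P\<^esub> F p d) (h \<otimes> q)) \<one>"
    by (simp add: counit_lift)
  also have "\<dots> = sweedler P (\<lambda>p q. sweedler P (\<lambda>a b. sweedler P (\<lambda>c d. \<epsilon> (a \<otimes> c) \<odot>\<^bsub>P\<^esub> F p (b \<otimes> d)) q) h) \<one>"
    by (simp add: comult_mult_lift)
  also have "\<dots> = sweedler P (\<lambda>a b. sweedler P (\<lambda>p q. sweedler P (\<lambda>c d. \<epsilon> (a \<otimes> c) \<odot>\<^bsub>P\<^esub> F p (b \<otimes> d)) q) \<one>) h"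
    by (rule lift_swap) simp_all
  also have "\<dots> = sweedler P (\<lambda>a b. sweedler P (\<lambda>p q. sweedler P (\<lambda>c d. \<epsilon> (a \<otimes> (c \<otimes> q)) \<odot>\<^bsub>P\<^esub> F p (b \<otimes> d)) \<one>) \<one>) h"
    by (simp add: coassoc_lift[symmetric] right_comonoidal_lift)
  also have "\<dots> = sweedler P (\<lambda>p q. sweedler P (\<lambda>a b. sweedler P (\<lambda>c d. \<epsilon> (a \<otimes> c \<otimes> q) \<odot>\<^bsub>P\<^esub> F p (b \<otimes> d)) \<one>) h) \<one>"
    by (subst lift_swap) (simp_all add: m_assoc)
  also have "\<dots> = sweedler P (\<lambda>p q. sweedler P (\<lambda>a b. \<epsilon> (a \<otimes> q) \<odot>\<^bsub>P\<^esub> F p b) (h \<otimes> \<one>)) \<one>"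
    by (simp add: comult_mult_lift del: r_one)
  also have "\<dots> = sweedler P (\<lambda>a b. F (\<epsilon>\<^sub>s a) b) h"
    by (simp add: eps_s_sweedler push) (rule lift_swap; simp)
  finally show ?thesis ..
qed

text \<open>
  The mirror image of the preceding argument, which needs the other comonoidality axiom.
\<close>

lemma comult_eps_s_bar:
  assumes P [simp]: "module R P" and F: "bilinear_map R H H P F" and h [simp]: "h \<in> carrier H"
  shows "sweedler P (\<lambda>a b. F (\<epsilon>\<^sub>s' a) b) h = sweedler P (\<lambda>a b. F a (b \<otimes> h)) \<one>"
proof -
  note [simp] = bilinear_rules[OF F]
  have "sweedler P (\<lambda>p q. F p (q \<otimes> h)) \<one>
     = sweedler P (\<lambda>p q. sweedler P (\<lambda>c d. \<epsilon> c \<odot>\<^bsub>P\<^esub> F p d) (q \<otimes> h)) \<one>"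
    by (simp add: counit_lift)
  also have "\<dots> = sweedler P (\<lambda>p q. sweedler P (\<lambda>c d. sweedler P (\<lambda>a b. \<epsilon> (c \<otimes> a) \<odot>\<^bsub>P\<^esub> F p (d \<otimes> b)) h) q) \<one>"
    by (simp add: comult_mult_lift)
  also have "\<dots> = sweedler P (\<lambda>p q. sweedler P (\<lambda>c d. sweedler P (\<lambda>a b. \<epsilon> (q \<otimes> c \<otimes> a) \<odot>\<^bsub>P\<^esub> F p (d \<otimes> b)) h) \<one>) \<one>"
    by (simp add: coassoc_lift[symmetric] left_comonoidal_lift)
  also have "\<dots> = sweedler P (\<lambda>p q. sweedler P (\<lambda>a b. \<epsilon> (q \<otimes> a) \<odot>\<^bsub>P\<^esub> F p b) (\<one> \<otimes> h)) \<one>"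
    by (simp add: comult_mult_lift m_assoc del: l_one)
  also have "\<dots> = sweedler P (\<lambda>a b. F (\<epsilon>\<^sub>s' a) b) h"
    by (simp add: eps_s_sweedler push) (rule lift_swap; simp)
  finally show ?thesis ..
qed

lemma scalar_comm: "\<lbrakk>a \<in> carrier R; b \<in> carrier R\<rbrakk> \<Longrightarrow> a \<otimes>\<^bsub>R\<^esub> b = b \<otimes>\<^bsub>R\<^esub> a"
  by (meson carrier_modules(2) cring.cring_simprules(14))

text \<open>
  The monoidality axioms with \<open>\<one>\<close> in the middle: the right one gives the formula for \<open>\<epsilon>\<^sub>s\<close>, the
  left one the formula for \<open>\<epsilon>\<^sub>s'\<close>.
\<close>

lemma counit_eps_s:
  assumes "k \<in> carrier H" "l \<in> carrier H"
  shows "\<epsilon> (\<epsilon>\<^sub>s k \<otimes> l) = \<epsilon> (k \<otimes> l)" and "\<epsilon> (k \<otimes> \<epsilon>\<^sub>s' l) = \<epsilon> (k \<otimes> l)"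
  using right_monoidal[of k \<one> l] left_monoidal[of k \<one> l] assms
  by (simp_all add: eps_s_sweedler push scalar_comm)

lemma counit_source:
  assumes "h \<in> carrier H"
  shows "\<epsilon> (\<epsilon>\<^sub>s h) = \<epsilon> h" and "\<epsilon> (\<epsilon>\<^sub>s' h) = \<epsilon> h"
  using counit_eps_s(1)[of h \<one>] counit_eps_s(2)[of \<one> h] assms by simp_all

lemma eps_s_mult:
  assumes "k \<in> carrier H" "l \<in> carrier H"
  shows "\<epsilon>\<^sub>s (\<epsilon>\<^sub>s k \<otimes> l) = \<epsilon>\<^sub>s (k \<otimes> l)" and "\<epsilon>\<^sub>s' (k \<otimes> \<epsilon>\<^sub>s' l) = \<epsilon>\<^sub>s' (k \<otimes> l)"
proof -
  show "\<epsilon>\<^sub>s (\<epsilon>\<^sub>s k \<otimes> l) = \<epsilon>\<^sub>s (k \<otimes> l)"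
    unfolding eps_s_sweedler(1)[of "_ \<otimes> l"] using assms by (simp add: m_assoc counit_eps_s(1))
  show "\<epsilon>\<^sub>s' (k \<otimes> \<epsilon>\<^sub>s' l) = \<epsilon>\<^sub>s' (k \<otimes> l)"
    unfolding eps_s_sweedler(2)[of "k \<otimes> _"] using assms by (simp add: counit_eps_s(2) flip: m_assoc)
qed

text \<open>
  After expanding the projection, multiplicativity contracts the coproducts of \<open>h\<close> and \<open>\<one>\<close>
  to the coproduct of \<open>h\<one>\<close> or \<open>\<one>h\<close>, and both legs meet the counit.
\<close>

lemma counit_mult_eps_s:
  assumes [simp]: "h \<in> carrier H"
  shows "sweedler (scalar_module R) (\<lambda>a b. \<epsilon> (a \<otimes> \<epsilon>\<^sub>s b)) h = \<epsilon> h"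
    and "sweedler (scalar_module R) (\<lambda>a b. \<epsilon> (\<epsilon>\<^sub>s' b \<otimes> a)) h = \<epsilon> h"
proof -
  have c: "sweedler (scalar_module R) (\<lambda>a b. \<epsilon> b \<otimes>\<^bsub>R\<^esub> \<epsilon> a) h = \<epsilon> h"
    using counit_lift(2)[of "scalar_module R" h \<epsilon>] counit_hom by (simp add: module_scalar_module)
  have "sweedler (scalar_module R) (\<lambda>a b. \<epsilon> (a \<otimes> \<epsilon>\<^sub>s b)) h
    = sweedler (scalar_module R) (\<lambda>a b. \<epsilon> b \<otimes>\<^bsub>R\<^esub> \<epsilon> a) (h \<otimes> \<one>)"
    by (simp add: comult_mult_lift eps_s_sweedler push del: r_one)
  then show "sweedler (scalar_module R) (\<lambda>a b. \<epsilon> (a \<otimes> \<epsilon>\<^sub>s b)) h = \<epsilon> h" by (simp add: c)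
  have "sweedler (scalar_module R) (\<lambda>a b. \<epsilon> (\<epsilon>\<^sub>s' b \<otimes> a)) h
    = sweedler (scalar_module R) (\<lambda>a b. sweedler (scalar_module R) (\<lambda>c d. \<epsilon> (d \<otimes> b) \<otimes>\<^bsub>R\<^esub> \<epsilon> (c \<otimes> a)) \<one>) h"
    by (simp add: eps_s_sweedler push)
  also have "\<dots> = sweedler (scalar_module R) (\<lambda>c d. sweedler (scalar_module R) (\<lambda>a b. \<epsilon> (d \<otimes> b) \<otimes>\<^bsub>R\<^esub> \<epsilon> (c \<otimes> a)) h) \<one>"
    by (rule lift_swap) simp_all
  also have "\<dots> = sweedler (scalar_module R) (\<lambda>a b. \<epsilon> b \<otimes>\<^bsub>R\<^esub> \<epsilon> a) (\<one> \<otimes> h)"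
    by (simp add: comult_mult_lift del: l_one)
  finally show "sweedler (scalar_module R) (\<lambda>a b. \<epsilon> (\<epsilon>\<^sub>s' b \<otimes> a)) h = \<epsilon> h" by (simp add: c)
qed

text \<open>
  Both sides equal \<open>\<epsilon>(h1\<^sub>(\<^sub>2\<^sub>)g) 1\<^sub>(\<^sub>1\<^sub>)\<close>.
\<close>

lemma eps_s_exchange:
  assumes "h \<in> carrier H" "g \<in> carrier H"
  shows "sweedler H (\<lambda>a b. \<epsilon> (b \<otimes> g) \<odot> \<epsilon>\<^sub>s a) h = sweedler H (\<lambda>a b. \<epsilon> (h \<otimes> b) \<odot> \<epsilon>\<^sub>s' a) g"
  using comult_eps_s[of H "\<lambda>u v. \<epsilon> (v \<otimes> g) \<odot> u" h] comult_eps_s_bar[of H "\<lambda>u v. \<epsilon> (h \<otimes> v) \<odot> u" g] assms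
  by (simp add: m_assoc)

lemma source_hom [simp]:
  "f \<in> module_hom R M H \<Longrightarrow> (\<lambda>x. \<epsilon>\<^sub>s (f x)) \<in> module_hom R M H\<^sub>s"
  "f \<in> module_hom R M H \<Longrightarrow> (\<lambda>x. \<epsilon>\<^sub>s' (f x)) \<in> module_hom R M H\<^sub>s"
  "(\<lambda>x. x) \<in> module_hom R H\<^sub>s H"
proof -
  note E = eps_s_hom[OF hom_id, THEN module_homD(2)] eps_s_hom[OF hom_id, THEN module_homD(3)]
  have "\<epsilon>\<^sub>s \<in> module_hom R H H\<^sub>s" "\<epsilon>\<^sub>s' \<in> module_hom R H H\<^sub>s" by (rule module_homI; simp add: E source_smult)+
  then show "f \<in> module_hom R M H \<Longrightarrow> (\<lambda>x. \<epsilon>\<^sub>s (f x)) \<in> module_hom R M H\<^sub>s"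
    "f \<in> module_hom R M H \<Longrightarrow> (\<lambda>x. \<epsilon>\<^sub>s' (f x)) \<in> module_hom R M H\<^sub>s"
    by (simp_all add: hom_comp)
qed (rule module_homI; simp add: source_smult)

abbreviation "\<Delta>\<^sub>s \<equiv> source_comult R H \<Delta> \<epsilon>"

lemma source_comult_lift_one:
  assumes [simp]: "module R P" "y \<in> carrier H\<^sub>s" and F: "bilinear_map R H\<^sub>s H\<^sub>s P F"
  shows "tensor_lift R H\<^sub>s H\<^sub>s P F (\<Delta>\<^sub>s y) = sweedler P (\<lambda>a b. F (\<epsilon>\<^sub>s a) (\<epsilon>\<^sub>s (y \<otimes> b))) \<one>"
  unfolding source_comult_def Let_def
  by (simp add: push bilinear_rules[OF F] tensor_lift F)

text \<open>
  The projection \<open>\<epsilon>\<^sub>s : H \<rightarrow> H\<^sub>s\<close> is comultiplicative. As it is surjective and preserves the counit, \<open>H\<^sub>s\<close>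
  inherits the coalgebra axioms from \<open>H\<close>.
\<close>

lemma source_comult_eps_s:
  assumes [simp]: "module R P" "h \<in> carrier H" and F: "bilinear_map R H\<^sub>s H\<^sub>s P F"
  shows "tensor_lift R H\<^sub>s H\<^sub>s P F (\<Delta>\<^sub>s (\<epsilon>\<^sub>s h)) = sweedler P (\<lambda>a b. F (\<epsilon>\<^sub>s a) (\<epsilon>\<^sub>s b)) h"
  using comult_eps_s[of P "\<lambda>a b. F (\<epsilon>\<^sub>s a) (\<epsilon>\<^sub>s b)" h]
  by (simp add: source_comult_lift_one F bilinear_rules[OF F] eps_s_mult)

text \<open>
  The first leg of \<open>\<Delta>(\<one>)\<close> lies in \<open>H\<^sub>s\<close>.
\<close>

lemma source_leg_one:
  assumes [simp]: "module R P" and F: "bilinear_map R H H P F"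
  shows "sweedler P (\<lambda>a b. F (\<epsilon>\<^sub>s a) b) \<one> = sweedler P F \<one>" "sweedler P (\<lambda>a b. F (\<epsilon>\<^sub>s' a) b) \<one> = sweedler P F \<one>"
  using comult_eps_s[of P F \<one>] comult_eps_s_bar[of P F \<one>] F by simp_all

text \<open>
  The defining sums of the projections, evaluated on a map \<open>f\<close> that is linear only on \<open>H\<^sub>s\<close>. The argument \<open>\<epsilon>\<^sub>s a\<close>
  in place of \<open>a\<close> keeps every summand inside \<open>H\<^sub>s\<close>.
\<close>

lemma eps_s_expand:
  assumes [simp]: "module R P" and F: "f \<in> module_hom R H\<^sub>s P" and [simp]: "h \<in> carrier H"
  shows "f (\<epsilon>\<^sub>s h) = sweedler P (\<lambda>a b. \<epsilon> (h \<otimes> b) \<odot>\<^bsub>P\<^esub> f (\<epsilon>\<^sub>s a)) \<one>"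
    and "f (\<epsilon>\<^sub>s' h) = sweedler P (\<lambda>a b. \<epsilon> (b \<otimes> h) \<odot>\<^bsub>P\<^esub> f (\<epsilon>\<^sub>s a)) \<one>"
proof -
  have fe: "(\<lambda>x. f (\<epsilon>\<^sub>s x)) \<in> module_hom R H P" by (rule hom_comp[OF F]) simp
  have "f (\<epsilon>\<^sub>s (\<epsilon>\<^sub>s h)) = sweedler P (\<lambda>a b. f (\<epsilon>\<^sub>s (\<epsilon> (h \<otimes> b) \<odot> a))) \<one>"
    unfolding eps_s_sweedler(1)[of h] by (rule lift_push[OF _ _ _ _ _ fe]) simp_all
  then show "f (\<epsilon>\<^sub>s h) = sweedler P (\<lambda>a b. \<epsilon> (h \<otimes> b) \<odot>\<^bsub>P\<^esub> f (\<epsilon>\<^sub>s a)) \<one>"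
    by (simp add: module_homD(3)[OF fe])
  have "f (\<epsilon>\<^sub>s (\<epsilon>\<^sub>s' h)) = sweedler P (\<lambda>a b. f (\<epsilon>\<^sub>s (\<epsilon> (b \<otimes> h) \<odot> a))) \<one>"
    unfolding eps_s_sweedler(2)[of h] by (rule lift_push[OF _ _ _ _ _ fe]) simp_all
  then show "f (\<epsilon>\<^sub>s' h) = sweedler P (\<lambda>a b. \<epsilon> (b \<otimes> h) \<odot>\<^bsub>P\<^esub> f (\<epsilon>\<^sub>s a)) \<one>"
    by (simp add: module_homD(3)[OF fe])
qed

text \<open>
  The map \<open>\<epsilon>\<^sub>s'\<close> reverses the comultiplication. With \<open>y = \<epsilon>\<^sub>s'(h)\<close> the left side is
  \<open>\<epsilon>(y1\<^sub>(\<^sub>2\<^sub>)1\<^sub>(\<^sub>2\<^sub>')) 1\<^sub>(\<^sub>1\<^sub>) \<otimes> 1\<^sub>(\<^sub>1\<^sub>')\<close> and the right side is \<open>\<epsilon>(1\<^sub>(\<^sub>2\<^sub>)1\<^sub>(\<^sub>2\<^sub>')y) 1\<^sub>(\<^sub>1\<^sub>) \<otimes> 1\<^sub>(\<^sub>1\<^sub>')\<close>. They agree because \<open>y\<close> commutes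
  with the second leg of \<open>\<Delta>(\<one>)\<close>, by the two forms of \<open>\<Delta>(y)\<close>.
\<close>

lemma source_comult_eps_s_bar:
  assumes P [simp]: "module R P" and h [simp]: "h \<in> carrier H" and F: "bilinear_map R H\<^sub>s H\<^sub>s P F"
  shows "tensor_lift R H\<^sub>s H\<^sub>s P F (\<Delta>\<^sub>s (\<epsilon>\<^sub>s' h)) = sweedler P (\<lambda>a b. F (\<epsilon>\<^sub>s' b) (\<epsilon>\<^sub>s' a)) h"
proof -
  note [simp] = bilinear_rules[OF F]
  define y where "y = \<epsilon>\<^sub>s' h"
  have y [simp]: "y \<in> carrier H\<^sub>s" by (simp add: y_def)
  let ?G = "\<lambda>a c. F (\<epsilon>\<^sub>s a) (\<epsilon>\<^sub>s c)"
  have "tensor_lift R H\<^sub>s H\<^sub>s P F (\<Delta>\<^sub>s y) = sweedler P (\<lambda>a b. sweedler P (\<lambda>c d. \<epsilon> (y \<otimes> b \<otimes> d) \<odot>\<^bsub>P\<^esub> ?G a c) \<one>) \<one>"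
    by (simp add: source_comult_lift_one F eps_s_expand(1)[of P "F _" "y \<otimes> _"])
  also have "\<dots> = sweedler P (\<lambda>c d. sweedler P (\<lambda>a b. \<epsilon> (y \<otimes> b \<otimes> d) \<odot>\<^bsub>P\<^esub> ?G a c) \<one>) \<one>"
    by (rule lift_swap) simp_all
  \<comment> \<open>The legs \<open>a, b\<close> are those of the inner unit, so \<open>y\<close> moves past \<open>b\<close>; after an interchange it moves past \<open>d\<close>.\<close>
  also have "\<dots> = sweedler P (\<lambda>c d. sweedler P (\<lambda>a b. \<epsilon> (b \<otimes> y \<otimes> d) \<odot>\<^bsub>P\<^esub> ?G a c) \<one>) \<one>"
    by (simp flip: comult_source[of P "\<lambda>a b. \<epsilon> (b \<otimes> _) \<odot>\<^bsub>P\<^esub> ?G a _" y])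
  also have "\<dots> = sweedler P (\<lambda>a b. sweedler P (\<lambda>c d. \<epsilon> (b \<otimes> (y \<otimes> d)) \<odot>\<^bsub>P\<^esub> ?G a c) \<one>) \<one>"
    by (subst lift_swap) (simp_all add: m_assoc)
  also have "\<dots> = sweedler P (\<lambda>a b. sweedler P (\<lambda>c d. \<epsilon> (b \<otimes> (d \<otimes> y)) \<odot>\<^bsub>P\<^esub> ?G a c) \<one>) \<one>"
    by (simp flip: comult_source[of P "\<lambda>c d. \<epsilon> (_ \<otimes> d) \<odot>\<^bsub>P\<^esub> ?G _ c" y])
  also have "\<dots> = sweedler P (\<lambda>c d. sweedler P (\<lambda>a b. \<epsilon> (b \<otimes> (d \<otimes> y)) \<odot>\<^bsub>P\<^esub> ?G a c) \<one>) \<one>"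
    by (rule lift_swap) simp_all
  also have "\<dots> = sweedler P (\<lambda>c d. F (\<epsilon>\<^sub>s' (d \<otimes> y)) (\<epsilon>\<^sub>s c)) \<one>"
    by (simp add: eps_s_expand(2)[of P "\<lambda>x. F x _"])
  also have "\<dots> = sweedler P (\<lambda>c d. F (\<epsilon>\<^sub>s' (d \<otimes> h)) (\<epsilon>\<^sub>s c)) \<one>"
    by (simp add: y_def eps_s_mult)
  also have "\<dots> = sweedler P (\<lambda>c d. F (\<epsilon>\<^sub>s' (d \<otimes> h)) (\<epsilon>\<^sub>s' c)) \<one>"
    using source_leg_one(1)[of P "\<lambda>c d. F (\<epsilon>\<^sub>s' (d \<otimes> h)) (\<epsilon>\<^sub>s' c)"] by simp
  also have "\<dots> = sweedler P (\<lambda>a b. F (\<epsilon>\<^sub>s' b) (\<epsilon>\<^sub>s' a)) h"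
    using comult_eps_s_bar[of P "\<lambda>a b. F (\<epsilon>\<^sub>s' b) (\<epsilon>\<^sub>s' a)" h] by simp
  finally show ?thesis by (simp add: y_def)
qed

text \<open>
  Both sides are \<open>\<epsilon>(1\<^sub>(\<^sub>2\<^sub>)h1\<^sub>(\<^sub>2\<^sub>')) 1\<^sub>(\<^sub>1\<^sub>) \<otimes> 1\<^sub>(\<^sub>1\<^sub>')\<close>.
\<close>

lemma source_legs_commute:
  assumes P [simp]: "module R P" and h [simp]: "h \<in> carrier H" and F: "bilinear_map R H\<^sub>s H\<^sub>s P F"
  shows "sweedler P (\<lambda>a b. F (\<epsilon>\<^sub>s' a) (\<epsilon>\<^sub>s b)) h = sweedler P (\<lambda>a b. F (\<epsilon>\<^sub>s' b) (\<epsilon>\<^sub>s a)) h"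
proof -
  note [simp] = bilinear_rules[OF F]
  have "sweedler P (\<lambda>a b. F (\<epsilon>\<^sub>s' a) (\<epsilon>\<^sub>s b)) h = sweedler P (\<lambda>a b. F (\<epsilon>\<^sub>s a) (\<epsilon>\<^sub>s (b \<otimes> h))) \<one>"
    using comult_eps_s_bar[of P "\<lambda>a b. F (\<epsilon>\<^sub>s' a) (\<epsilon>\<^sub>s b)" h] source_leg_one(1)[of P "\<lambda>a b. F (\<epsilon>\<^sub>s' a) (\<epsilon>\<^sub>s (b \<otimes> h))"]
    by simp
  also have "\<dots> = sweedler P (\<lambda>a b. sweedler P (\<lambda>c d. \<epsilon> (b \<otimes> h \<otimes> d) \<odot>\<^bsub>P\<^esub> F (\<epsilon>\<^sub>s a) (\<epsilon>\<^sub>s c)) \<one>) \<one>"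
    by (simp add: eps_s_expand(1)[of P "F _" "_ \<otimes> h"])
  also have "\<dots> = sweedler P (\<lambda>c d. sweedler P (\<lambda>a b. \<epsilon> (b \<otimes> h \<otimes> d) \<odot>\<^bsub>P\<^esub> F (\<epsilon>\<^sub>s a) (\<epsilon>\<^sub>s c)) \<one>) \<one>"
    by (rule lift_swap) simp_all
  also have "\<dots> = sweedler P (\<lambda>c d. F (\<epsilon>\<^sub>s' (h \<otimes> d)) (\<epsilon>\<^sub>s c)) \<one>"
    by (simp add: eps_s_expand(2)[of P "\<lambda>x. F x _"] m_assoc)
  also have "\<dots> = sweedler P (\<lambda>a b. F (\<epsilon>\<^sub>s' b) (\<epsilon>\<^sub>s a)) h"
    using comult_eps_s[of P "\<lambda>a b. F (\<epsilon>\<^sub>s' b) (\<epsilon>\<^sub>s a)" h] by simp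
  finally show ?thesis .
qed

lemma source_comult_hom: "\<Delta>\<^sub>s \<in> module_hom R H\<^sub>s (tensor R H\<^sub>s H\<^sub>s)"
  unfolding source_comult_def[abs_def] Let_def by simp

lemma source_coalgebra: "coalgebra R H\<^sub>s \<Delta>\<^sub>s \<epsilon>"
proof -
  note [simp] = hom_comp[OF source_comult_hom] source_comult_hom module_homD(1)[OF source_comult_hom]
  interpret S: module R H\<^sub>s by simp
  show ?thesis
  proof
    show "\<Delta>\<^sub>s \<in> module_hom R H\<^sub>s (tensor R H\<^sub>s H\<^sub>s)" by simp
    show "\<epsilon> \<in> module_hom R H\<^sub>s (scalar_module R)" by simp
    fix y assume y [simp]: "y \<in> carrier H\<^sub>s"
    note lift = source_comult_eps_s[of _ y, simplified]
    show "tensor_assoc R H\<^sub>s H\<^sub>s H\<^sub>s (tensor_map R H\<^sub>s H\<^sub>s (tensor R H\<^sub>s H\<^sub>s) H\<^sub>s \<Delta>\<^sub>s id (\<Delta>\<^sub>s y))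
        = tensor_map R H\<^sub>s H\<^sub>s H\<^sub>s (tensor R H\<^sub>s H\<^sub>s) id \<Delta>\<^sub>s (\<Delta>\<^sub>s y)"
      by (simp add: tensor_assoc_map_left tensor_map_right lift source_comult_eps_s coassoc_lift)
    show "tensor_lift R H\<^sub>s H\<^sub>s H\<^sub>s (\<lambda>x y. \<epsilon> x \<odot>\<^bsub>H\<^sub>s\<^esub> y) (\<Delta>\<^sub>s y) = y"
      using counit_lift(1)[of H\<^sub>s y \<epsilon>\<^sub>s] by (simp add: lift counit_source)
    show "tensor_lift R H\<^sub>s H\<^sub>s H\<^sub>s (\<lambda>x y. \<epsilon> y \<odot>\<^bsub>H\<^sub>s\<^esub> x) (\<Delta>\<^sub>s y) = y"
      using counit_lift(2)[of H\<^sub>s y \<epsilon>\<^sub>s] by (simp add: lift counit_source)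
  qed
qed

lemma mult_source_counit_lift:
  assumes [simp]: "module R P" "y \<in> carrier H\<^sub>s" "h \<in> carrier H" and f: "f \<in> module_hom R H P"
  shows "sweedler P (\<lambda>a b. \<epsilon> (b \<otimes> y) \<odot>\<^bsub>P\<^esub> f a) h = f (h \<otimes> y)"
    and "sweedler P (\<lambda>a b. \<epsilon> (y \<otimes> b) \<odot>\<^bsub>P\<^esub> f a) h = f (y \<otimes> h)"
proof -
  note [simp] = module_homD[OF f]
  have "f (sweedler H (\<lambda>a b. \<epsilon> (b \<otimes> y) \<odot> a) h) = sweedler P (\<lambda>a b. f (\<epsilon> (b \<otimes> y) \<odot> a)) h"
    "f (sweedler H (\<lambda>a b. \<epsilon> (y \<otimes> b) \<odot> a) h) = sweedler P (\<lambda>a b. f (\<epsilon> (y \<otimes> b) \<odot> a)) h"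
    by (rule lift_push[OF _ _ _ _ _ f]; simp)+
  then show "sweedler P (\<lambda>a b. \<epsilon> (b \<otimes> y) \<odot>\<^bsub>P\<^esub> f a) h = f (h \<otimes> y)"
    and "sweedler P (\<lambda>a b. \<epsilon> (y \<otimes> b) \<odot>\<^bsub>P\<^esub> f a) h = f (y \<otimes> h)"
    by (simp_all add: mult_source_counit)
qed

lemma eps_s_exchange_lift:
  assumes [simp]: "module R P" "h \<in> carrier H" "g \<in> carrier H" and f: "f \<in> module_hom R H\<^sub>s P"
  shows "sweedler P (\<lambda>a b. \<epsilon> (b \<otimes> g) \<odot>\<^bsub>P\<^esub> f (\<epsilon>\<^sub>s a)) h = sweedler P (\<lambda>a b. \<epsilon> (h \<otimes> b) \<odot>\<^bsub>P\<^esub> f (\<epsilon>\<^sub>s' a)) g"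
proof -
  \<comment> \<open>A sum of elements of \<open>H\<^sub>s\<close> is the same taken in \<open>H\<^sub>s\<close> or in \<open>H\<close>; \<open>f\<close> is linear on \<open>H\<^sub>s\<close> only.\<close>
  have [simp]: "sweedler H\<^sub>s F k = sweedler H F k" if "bilinear_map R H H H\<^sub>s F" "k \<in> carrier H" for F k
    using that lift_push[of R H H H\<^sub>s H F "\<lambda>x. x" "\<Delta> k"] by simp
  note [simp] = module_homD[OF f] eps_s_exchange[folded source_smult]
  have "sweedler P (\<lambda>a b. f (\<epsilon> (b \<otimes> g) \<odot>\<^bsub>H\<^sub>s\<^esub> \<epsilon>\<^sub>s a)) h = f (sweedler H\<^sub>s (\<lambda>a b. \<epsilon> (b \<otimes> g) \<odot>\<^bsub>H\<^sub>s\<^esub> \<epsilon>\<^sub>s a) h)"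
    "sweedler P (\<lambda>a b. f (\<epsilon> (h \<otimes> b) \<odot>\<^bsub>H\<^sub>s\<^esub> \<epsilon>\<^sub>s' a)) g = f (sweedler H\<^sub>s (\<lambda>a b. \<epsilon> (h \<otimes> b) \<odot>\<^bsub>H\<^sub>s\<^esub> \<epsilon>\<^sub>s' a) g)"
    by (rule lift_push[OF _ _ _ _ _ f, symmetric]; simp)+
  then show ?thesis by simp
qed

end

section \<open>Comodules as bimodules and bicomodules over the source base\<close>

locale weak_bialgebra_comodule = weak_bialgebra R H \<Delta> \<epsilon> + M: right_comodule R H \<Delta> \<epsilon> M \<rho>
  for R and H (structure) and \<Delta> and \<epsilon> and M and \<rho>
begin

abbreviation coact where "coact P F m \<equiv> tensor_lift R M H P F (\<rho> m)"

lemma coact_closed [simp]: "module R M" "m \<in> carrier M \<Longrightarrow> \<rho> m \<in> carrier (tensor R M H)"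
  using module_homD(1)[OF M.right_coact_hom] M.module_axioms by simp_all

lemma coact_hom [simp]: "f \<in> module_hom R A M \<Longrightarrow> (\<lambda>x. \<rho> (f x)) \<in> module_hom R A (tensor R M H)"
  by (rule hom_comp[OF M.right_coact_hom])

lemma coact_smult [simp]: "\<lbrakk>s \<in> carrier R; x \<in> carrier M\<rbrakk> \<Longrightarrow> \<rho> (s \<odot>\<^bsub>M\<^esub> x) = s \<odot>\<^bsub>tensor R M H\<^esub> \<rho> x"
  using module_homD(3)[OF M.right_coact_hom] by simp

lemma coact_push [push]:
  assumes "module R A" "module R B" "bilinear_map R A B M F" "t \<in> carrier (tensor R A B)"
  shows "\<rho> (tensor_lift R A B M F t) = tensor_lift R A B (tensor R M H) (\<lambda>a b. \<rho> (F a b)) t"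
  by (rule lift_push; use assms M.right_coact_hom in simp)

lemma coact_coassoc:
  assumes "module R P" "m \<in> carrier M" "trilinear_map R M H H P F"
  shows "coact P (\<lambda>x c. coact P (\<lambda>p q. F p q c) x) m = coact P (\<lambda>x h. sweedler P (\<lambda>a b. F x a b) h) m"
  by (rule trilinear_transfer) (use assms M.right_coact_coassoc M.right_coact_hom comult_hom in simp_all)

abbreviation "lact \<equiv> source_left_act R H \<epsilon> M \<rho>"
abbreviation "ract \<equiv> source_right_act R H \<epsilon> M \<rho>"

lemma act_closed [simp]:
  assumes "y \<in> carrier H" "m \<in> carrier M" shows "lact y m \<in> carrier M" "ract m y \<in> carrier M"
  using assms by (simp_all add: source_left_act_def source_right_act_def)

lemma act_hom [simp]:
  "\<lbrakk>y \<in> carrier H; f \<in> module_hom R A M\<rbrakk> \<Longrightarrow> (\<lambda>x. lact y (f x)) \<in> module_hom R A M"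
  "\<lbrakk>y \<in> carrier H; f \<in> module_hom R A M\<rbrakk> \<Longrightarrow> (\<lambda>x. ract (f x) y) \<in> module_hom R A M"
  "\<lbrakk>m \<in> carrier M; g \<in> module_hom R B H\<rbrakk> \<Longrightarrow> (\<lambda>x. lact (g x) m) \<in> module_hom R B M"
  "\<lbrakk>m \<in> carrier M; g \<in> module_hom R B H\<rbrakk> \<Longrightarrow> (\<lambda>x. ract m (g x)) \<in> module_hom R B M"
  by (simp_all add: source_left_act_def source_right_act_def hom_comp module_homD)

text \<open>
  By coassociativity the coaction of \<open>y \<triangleright> m\<close> is \<open>\<epsilon>(ym\<^sub>[\<^sub>2\<^sub>]) m\<^sub>[\<^sub>0\<^sub>] \<otimes> m\<^sub>[\<^sub>1\<^sub>]\<close>, and the last two legs contract to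
  \<open>ym\<^sub>[\<^sub>1\<^sub>]\<close>; likewise on the other side.
\<close>

lemma coact_act:
  assumes [simp]: "module R P" "y \<in> carrier H\<^sub>s" "m \<in> carrier M" and F: "bilinear_map R M H P F"
  shows "coact P F (lact y m) = coact P (\<lambda>x h. F x (y \<otimes> h)) m"
    and "coact P F (ract m y) = coact P (\<lambda>x h. F x (h \<otimes> y)) m"
proof -
  note [simp] = bilinear_rules[OF F]
  show "coact P F (lact y m) = coact P (\<lambda>x h. F x (y \<otimes> h)) m"
    by (simp add: source_left_act_def push coact_coassoc mult_source_counit_lift)
  show "coact P F (ract m y) = coact P (\<lambda>x h. F x (h \<otimes> y)) m"
    by (simp add: source_right_act_def push coact_coassoc mult_source_counit_lift)
qed

lemma source_bimodule: "bimodule R H\<^sub>s M lact ract"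
proof (intro bimodule.intro source_algebra coact_closed(1) bimodule_axioms.intro)
  show "bilinear_map R H\<^sub>s M M lact" "bilinear_map R M H\<^sub>s M ract"
    by simp_all
  fix m assume [simp]: "m \<in> carrier M"
  show "lact \<one>\<^bsub>H\<^sub>s\<^esub> m = m" "ract m \<one>\<^bsub>H\<^sub>s\<^esub> = m"
    by (simp_all add: source_left_act_def source_right_act_def M.right_coact_counit)
  fix x y assume [simp]: "x \<in> carrier H\<^sub>s" "y \<in> carrier H\<^sub>s"
  show "lact (x \<otimes>\<^bsub>H\<^sub>s\<^esub> y) m = lact x (lact y m)"
    unfolding source_left_act_def[of _ _ _ _ _ x] source_left_act_def[of _ _ _ _ _ "_ \<otimes>\<^bsub>_\<^esub> _"]
    by (simp add: coact_act m_assoc)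
  show "ract m (x \<otimes>\<^bsub>H\<^sub>s\<^esub> y) = ract (ract m x) y"
    unfolding source_right_act_def[of _ _ _ _ _ _ y] source_right_act_def[of _ _ _ _ _ _ "_ \<otimes>\<^bsub>_\<^esub> _"]
    by (simp add: coact_act m_assoc)
  show "ract (lact x m) y = lact x (ract m y)"
    unfolding source_right_act_def[of _ _ _ _ _ "lact x m"] source_left_act_def[of _ _ _ _ _ x "ract m y"]
    by (simp add: coact_act m_assoc)
qed

abbreviation "rcoact \<equiv> source_right_coact R H \<Delta> \<epsilon> M \<rho>"
abbreviation "lcoact \<equiv> source_left_coact R H \<Delta> \<epsilon> M \<rho>"

lemma source_coact_hom: "rcoact \<in> module_hom R M (tensor R M H\<^sub>s)" "lcoact \<in> module_hom R M (tensor R H\<^sub>s M)"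
  unfolding source_right_coact_def[abs_def] source_left_coact_def[abs_def] Let_def by simp_all

lemmas source_coact_simps [simp] = source_coact_hom module_homD(1)[OF source_coact_hom(1)]
  module_homD(1)[OF source_coact_hom(2)] hom_comp[OF source_coact_hom(1)] hom_comp[OF source_coact_hom(2)]

lemma source_coact_lift:
  assumes [simp]: "module R P" "m \<in> carrier M"
  shows "bilinear_map R M H\<^sub>s P F \<Longrightarrow> tensor_lift R M H\<^sub>s P F (rcoact m) = coact P (\<lambda>x h. F x (\<epsilon>\<^sub>s h)) m"
    and "bilinear_map R H\<^sub>s M P G \<Longrightarrow> tensor_lift R H\<^sub>s M P G (lcoact m) = coact P (\<lambda>x h. G (\<epsilon>\<^sub>s' h) x) m"
  unfolding source_right_coact_def source_left_coact_def Let_def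
  by (simp_all add: push bilinear_hom tensor_lift)

text \<open>
  Each axiom reduces, after coassociativity of \<open>\<rho>\<close>, to the corresponding property of \<open>\<epsilon>\<^sub>s\<close> and \<open>\<epsilon>\<^sub>s'\<close>:
  the left coaction is coassociative because \<open>\<epsilon>\<^sub>s'\<close> reverses the comultiplication, and the two
  coactions commute by \<open>source_legs_commute\<close>.
\<close>

lemma source_bicomodule: "bicomodule R H\<^sub>s \<Delta>\<^sub>s \<epsilon> M lcoact rcoact"
proof (intro bicomodule.intro left_comodule.intro right_comodule.intro source_coalgebra coact_closed(1)
    left_comodule_axioms.intro right_comodule_axioms.intro bicomodule_axioms.intro)
  fix m assume [simp]: "m \<in> carrier M"
  note [simp] = source_comult_hom hom_comp[OF source_comult_hom] module_homD(1)[OF source_comult_hom]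
  show "tensor_assoc R H\<^sub>s H\<^sub>s M (tensor_map R H\<^sub>s M (tensor R H\<^sub>s H\<^sub>s) M \<Delta>\<^sub>s id (lcoact m))
      = tensor_map R H\<^sub>s M H\<^sub>s (tensor R H\<^sub>s M) id lcoact (lcoact m)"
    by (simp add: tensor_assoc_map_left tensor_map_right source_coact_lift source_comult_eps_s_bar coact_coassoc)
  show "tensor_lift R H\<^sub>s M M (\<lambda>c x. \<epsilon> c \<odot>\<^bsub>M\<^esub> x) (lcoact m) = m"
    by (simp add: source_coact_lift counit_source M.right_coact_counit)
  show "tensor_assoc R M H\<^sub>s H\<^sub>s (tensor_map R M H\<^sub>s (tensor R M H\<^sub>s) H\<^sub>s rcoact id (rcoact m))
      = tensor_map R M H\<^sub>s M (tensor R H\<^sub>s H\<^sub>s) id \<Delta>\<^sub>s (rcoact m)"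
    by (simp add: tensor_assoc_map_left tensor_map_right source_coact_lift source_comult_eps_s coact_coassoc)
  show "tensor_lift R M H\<^sub>s M (\<lambda>x c. \<epsilon> c \<odot>\<^bsub>M\<^esub> x) (rcoact m) = m"
    by (simp add: source_coact_lift counit_source M.right_coact_counit)
  show "tensor_assoc R H\<^sub>s M H\<^sub>s (tensor_map R M H\<^sub>s (tensor R H\<^sub>s M) H\<^sub>s lcoact id (rcoact m))
      = tensor_map R H\<^sub>s M H\<^sub>s (tensor R M H\<^sub>s) id rcoact (lcoact m)"
    by (simp add: tensor_assoc_map_left tensor_map_right source_coact_lift coact_coassoc
        source_legs_commute[of _ _ "\<lambda>a b. pure R H\<^sub>s (tensor R M H\<^sub>s) a (pure R M H\<^sub>s _ b)"])
qed simp_all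

text \<open>
  The formula for the left action makes sense for all of \<open>H\<close>, although only \<open>H\<^sub>s\<close> acts; this
  allows writing \<open>\<pi>(m \<otimes> n)\<close> as \<open>m\<^sub>[\<^sub>0\<^sub>] \<otimes> \<epsilon>\<^sub>s(m\<^sub>[\<^sub>1\<^sub>]) \<triangleright> n\<close>.
\<close>

lemma act_eps_s:
  assumes "h \<in> carrier H" "m \<in> carrier M"
  shows "lact (\<epsilon>\<^sub>s h) m = lact h m"
  using assms by (simp add: source_left_act_def counit_eps_s)

lemma act_coact:
  assumes [simp]: "m \<in> carrier M"
  shows "coact M (\<lambda>x h. ract x (\<epsilon>\<^sub>s h)) m = m" "coact M (\<lambda>x h. lact (\<epsilon>\<^sub>s' h) x) m = m"
proof -
  have "sweedler M (\<lambda>a b. \<epsilon> (a \<otimes> \<epsilon>\<^sub>s b) \<odot>\<^bsub>M\<^esub> x) h = \<epsilon> h \<odot>\<^bsub>M\<^esub> x"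
    "sweedler M (\<lambda>a b. \<epsilon> (\<epsilon>\<^sub>s' b \<otimes> a) \<odot>\<^bsub>M\<^esub> x) h = \<epsilon> h \<odot>\<^bsub>M\<^esub> x"
    if "x \<in> carrier M" "h \<in> carrier H" for x h
    using that by (simp_all add: counit_mult_eps_s flip: lift_push_scalar)
  then show "coact M (\<lambda>x h. ract x (\<epsilon>\<^sub>s h)) m = m" "coact M (\<lambda>x h. lact (\<epsilon>\<^sub>s' h) x) m = m"
    by (simp_all add: source_left_act_def source_right_act_def coact_coassoc M.right_coact_counit)
qed

end

section \<open>The idempotent, the cotensor product and the balanced tensor product\<close>

locale weak_bialgebra_comodules = weak_bialgebra_comodule R H \<Delta> \<epsilon> M \<rho> + N: weak_bialgebra_comodule R H \<Delta> \<epsilon> N \<sigma>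
  for R and H (structure) and \<Delta> and \<epsilon> and M and \<rho> and N and \<sigma>
begin

abbreviation "T \<equiv> tensor R M N"
abbreviation "\<pi> \<equiv> tensor_proj R H \<epsilon> M \<rho> N \<sigma>"

lemma proj_hom: "\<pi> \<in> module_hom R T T"
  unfolding tensor_proj_def Let_def by (rule tensor_lift(1)) simp_all

lemmas proj_simps [simp] = proj_hom module_homD(1)[OF proj_hom] hom_comp[OF proj_hom]

text \<open>
  Linear maps out of \<open>M \<otimes> N\<close> may be computed after \<open>\<pi>\<close> without expanding \<open>\<pi>\<close> itself.
\<close>

lemma proj_lift:
  assumes [simp]: "module R P" "t \<in> carrier T" and F: "bilinear_map R M N P F"
  shows "tensor_lift R M N P F (\<pi> t)
    = tensor_lift R M N P (\<lambda>m n. coact P (\<lambda>x h. N.coact P (\<lambda>y g. \<epsilon> (h \<otimes> g) \<odot>\<^bsub>P\<^esub> F x y) n) m) t"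
  unfolding tensor_proj_def Let_def
  by (simp add: push bilinear_rules[OF F] tensor_lift F)

lemma proj_eq_lift:
  assumes [simp]: "t \<in> carrier T"
  shows "\<pi> t = tensor_lift R M N T (\<lambda>m n. coact T (\<lambda>x h. pure R M N x (N.lact h n)) m) t"
  using proj_lift[of T t "pure R M N"]
  by (simp add: lift_pure_id source_left_act_def push bilinear_smult[OF pure_bilinear])

lemma cotensor_iff:
  assumes t [simp]: "t \<in> carrier T"
  shows "t \<in> cotensor R H\<^sub>s M rcoact N N.lcoact \<longleftrightarrow>
    tensor_lift R M N (tensor R M (tensor R H\<^sub>s N)) (\<lambda>m n. coact (tensor R M (tensor R H\<^sub>s N))
        (\<lambda>x h. pure R M (tensor R H\<^sub>s N) x (pure R H\<^sub>s N (\<epsilon>\<^sub>s h) n)) m) t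
    = tensor_lift R M N (tensor R M (tensor R H\<^sub>s N)) (\<lambda>m n. N.coact (tensor R M (tensor R H\<^sub>s N))
        (\<lambda>y g. pure R M (tensor R H\<^sub>s N) m (pure R H\<^sub>s N (\<epsilon>\<^sub>s' g) y)) n) t"
  by (simp add: cotensor_def tensor_assoc_map_left tensor_map_right source_coact_lift N.source_coact_lift)

text \<open>
  Evaluate the defining equation of the cotensor product on the trilinear map
  \<open>x \<otimes> y \<otimes> n \<mapsto> x \<otimes> y \<triangleright> n\<close>.
\<close>

lemma cotensor_fixed:
  assumes t: "t \<in> cotensor R H\<^sub>s M rcoact N N.lcoact"
  shows "\<pi> t = t"
proof -
  have [simp]: "t \<in> carrier T" using t by (simp add: cotensor_def)
  have "tensor_lift R M N T (\<lambda>m n. tensor_lift R M H\<^sub>s T (\<lambda>x y. pure R M N x (N.lact y n)) (rcoact m)) t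
    = tensor_lift R M N T (\<lambda>m n. tensor_lift R H\<^sub>s N T (\<lambda>y n'. pure R M N m (N.lact y n')) (N.lcoact n)) t"
    by (rule trilinear_transfer[where A = M and B = H\<^sub>s and C = N])
      (use t in \<open>simp_all add: cotensor_def\<close>)
  also have "tensor_lift R M N T (\<lambda>m n. tensor_lift R M H\<^sub>s T (\<lambda>x y. pure R M N x (N.lact y n)) (rcoact m)) t = \<pi> t"
    by (simp add: source_coact_lift proj_eq_lift N.act_eps_s)
  also have "tensor_lift R M N T (\<lambda>m n. tensor_lift R H\<^sub>s N T (\<lambda>y n'. pure R M N m (N.lact y n')) (N.lcoact n)) t
    = tensor_lift R M N T (\<lambda>m n. pure R M N m (N.coact N (\<lambda>x h. N.lact (\<epsilon>\<^sub>s' h) x) n)) t"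
    by (simp add: N.source_coact_lift push)
  also have "\<dots> = t" by (simp add: N.act_coact lift_pure_id)
  finally show ?thesis .
qed

text \<open>
  Coassociativity of \<open>M\<close> and of \<open>N\<close> brings the two sides to \<open>\<epsilon>(m\<^sub>[\<^sub>2\<^sub>]n\<^sub>[\<^sub>1\<^sub>]) m\<^sub>[\<^sub>0\<^sub>] \<otimes> \<epsilon>\<^sub>s(m\<^sub>[\<^sub>1\<^sub>]) \<otimes> n\<^sub>[\<^sub>0\<^sub>]\<close> and
  \<open>\<epsilon>(m\<^sub>[\<^sub>1\<^sub>]n\<^sub>[\<^sub>2\<^sub>]) m\<^sub>[\<^sub>0\<^sub>] \<otimes> \<epsilon>\<^sub>s'(n\<^sub>[\<^sub>1\<^sub>]) \<otimes> n\<^sub>[\<^sub>0\<^sub>]\<close>, which the exchange law identifies.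
\<close>

lemma proj_cotensor:
  assumes s [simp]: "s \<in> carrier T"
  shows "\<pi> s \<in> cotensor R H\<^sub>s M rcoact N N.lcoact"
proof -
  let ?P = "tensor R M (tensor R H\<^sub>s N)"
  let ?f = "\<lambda>x y z. pure R M (tensor R H\<^sub>s N) x (pure R H\<^sub>s N z y)"
  have "coact ?P (\<lambda>x h. N.coact ?P (\<lambda>y g. \<epsilon> (h \<otimes> g) \<odot>\<^bsub>?P\<^esub> coact ?P (\<lambda>p q. ?f p y (\<epsilon>\<^sub>s q)) x) n) m
      = coact ?P (\<lambda>x h. N.coact ?P (\<lambda>y g. \<epsilon> (h \<otimes> g) \<odot>\<^bsub>?P\<^esub> N.coact ?P (\<lambda>p q. ?f x p (\<epsilon>\<^sub>s' q)) y) n) m"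
    (is "?L = ?Q")
    if [simp]: "m \<in> carrier M" "n \<in> carrier N" for m n
  proof -
    have "?L = coact ?P (\<lambda>x h. coact ?P (\<lambda>p q. N.coact ?P (\<lambda>y g. \<epsilon> (h \<otimes> g) \<odot>\<^bsub>?P\<^esub> ?f p y (\<epsilon>\<^sub>s q)) n) x) m"
      by (simp add: push) (rule lift_cong; (subst lift_swap)?; simp)
    also have "\<dots> = coact ?P (\<lambda>x h. sweedler ?P (\<lambda>a b. N.coact ?P (\<lambda>y g. \<epsilon> (b \<otimes> g) \<odot>\<^bsub>?P\<^esub> ?f x y (\<epsilon>\<^sub>s a)) n) h) m"
      by (simp add: coact_coassoc)
    also have "\<dots> = coact ?P (\<lambda>x h. N.coact ?P (\<lambda>y g. sweedler ?P (\<lambda>a b. \<epsilon> (b \<otimes> g) \<odot>\<^bsub>?P\<^esub> ?f x y (\<epsilon>\<^sub>s a)) h) n) m"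
      by (rule lift_cong; (subst lift_swap)?; simp)
    also have "\<dots> = coact ?P (\<lambda>x h. N.coact ?P (\<lambda>y g. sweedler ?P (\<lambda>a b. \<epsilon> (h \<otimes> b) \<odot>\<^bsub>?P\<^esub> ?f x y (\<epsilon>\<^sub>s' a)) g) n) m"
      by (simp add: eps_s_exchange_lift[of ?P _ _ "?f _ _"])
    also have "\<dots> = ?Q"
      by (simp add: N.coact_coassoc push)
    finally show ?thesis .
  qed
  then show ?thesis
    by (simp add: cotensor_iff proj_lift)
qed

lemma cotensor_eq_image: "cotensor R H\<^sub>s M rcoact N N.lcoact = tensor_image R H \<epsilon> M \<rho> N \<sigma>"
proof
  show "cotensor R H\<^sub>s M rcoact N N.lcoact \<subseteq> tensor_image R H \<epsilon> M \<rho> N \<sigma>"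
    using cotensor_fixed unfolding tensor_image_def by (metis (no_types, lifting) cotensor_def image_eqI mem_Collect_eq subsetI)
  show "tensor_image R H \<epsilon> M \<rho> N \<sigma> \<subseteq> cotensor R H\<^sub>s M rcoact N N.lcoact"
    by (auto simp: tensor_image_def proj_cotensor)
qed

lemma proj_balanced:
  assumes [simp]: "m \<in> carrier M" "y \<in> carrier H\<^sub>s" "n \<in> carrier N"
  shows "\<pi> (pure R M N (ract m y) n) = \<pi> (pure R M N m (N.lact y n))"
  unfolding tensor_proj_def Let_def
  by (simp add: tensor_lift coact_act N.coact_act m_assoc)

text \<open>
  Write \<open>\<pi>(m \<otimes> n)\<close> as \<open>m\<^sub>[\<^sub>0\<^sub>] \<otimes> \<epsilon>\<^sub>s(m\<^sub>[\<^sub>1\<^sub>]) \<triangleright> n\<close>, move \<open>\<epsilon>\<^sub>s(m\<^sub>[\<^sub>1\<^sub>])\<close> across, and use \<open>m\<^sub>[\<^sub>0\<^sub>] \<triangleleft> \<epsilon>\<^sub>s(m\<^sub>[\<^sub>1\<^sub>]) = m\<close>.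
\<close>

lemma balanced_proj:
  assumes P [simp]: "module R P" and B: "bilinear_map R M N P B"
    and bal: "\<And>m y n. \<lbrakk>m \<in> carrier M; y \<in> carrier H\<^sub>s; n \<in> carrier N\<rbrakk> \<Longrightarrow> B (ract m y) n = B m (N.lact y n)"
    and t [simp]: "t \<in> carrier T"
  shows "tensor_lift R M N P B (\<pi> t) = tensor_lift R M N P B t"
proof -
  note [simp] = bilinear_hom[OF B]
  have "B x (N.lact h n) = B (ract x (\<epsilon>\<^sub>s h)) n" if "x \<in> carrier M" "h \<in> carrier H" "n \<in> carrier N" for x h n
    using that by (simp add: bal N.act_eps_s)
  moreover have "N.coact P (\<lambda>y g. \<epsilon> (h \<otimes> g) \<odot>\<^bsub>P\<^esub> B x y) n = B x (N.lact h n)"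
    if "x \<in> carrier M" "h \<in> carrier H" "n \<in> carrier N" for x h n
    using that by (simp add: source_left_act_def bilinear_rules[OF B])
  moreover have "coact P (\<lambda>x h. B (ract x (\<epsilon>\<^sub>s h)) n) m = B (coact M (\<lambda>x h. ract x (\<epsilon>\<^sub>s h)) m) n"
    if "m \<in> carrier M" "n \<in> carrier N" for m n
    using that by (simp add: bilinear_rules[OF B])
  ultimately show ?thesis
    by (simp add: proj_lift B act_coact)
qed

abbreviation "relations \<equiv> {pure R M N (ract m y) n \<ominus>\<^bsub>T\<^esub> pure R M N m (N.lact y n) | m y n.
           m \<in> carrier M \<and> y \<in> carrier H\<^sub>s \<and> n \<in> carrier N}"

text \<open>
  The relations lie in the kernel because \<open>\<pi>\<close> is balanced. For the converse, apply \<open>balanced_proj\<close> to the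
  quotient map \<open>q\<close> by the relations: \<open>q(t) = q(\<pi>(t)) = 0\<close> when \<open>\<pi>(t) = 0\<close>.
\<close>

lemma kernel_eq_balanced: "a_kernel T T \<pi> = generated_submodule R T relations"
proof -
  interpret T: module R T by simp
  let ?L = "generated_submodule R T relations"
  let ?K = "a_kernel T T \<pi>"
  have K: "?K = {t \<in> carrier T. \<pi> t = \<zero>\<^bsub>T\<^esub>}" by (auto simp: a_kernel_def' )
  have "relations \<subseteq> carrier T" by auto
  note L = T.generated_submodule[OF this]
  show ?thesis
  proof
    have "submodule ?K R T" unfolding K by (rule T.hom_eq_submodule[OF _ _ T.zero_hom]) simp_all
    moreover have "relations \<subseteq> ?K"
    proof
      fix t assume "t \<in> relations"
      then obtain m y n where [simp]: "m \<in> carrier M" "y \<in> carrier H\<^sub>s" "n \<in> carrier N"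
        and t: "t = pure R M N (ract m y) n \<ominus>\<^bsub>T\<^esub> pure R M N m (N.lact y n)" by blast
      have "\<pi> t = \<pi> (pure R M N (ract m y) n) \<ominus>\<^bsub>T\<^esub> \<pi> (pure R M N m (N.lact y n))"
        unfolding t by (rule T.module_hom_minus(2)[OF T.module_axioms proj_hom]) simp_all
      also have "\<dots> = \<zero>\<^bsub>T\<^esub>" by (subst T.M.a_minus_eq_zero_iff) (simp_all add: proj_balanced)
      finally show "t \<in> ?K" by (simp add: K t)
    qed
    ultimately show "?L \<subseteq> ?K" by (rule L(3))
    interpret L: abelian_subgroup ?L T
      by (rule T.submodule_abelian_subgroup[OF L(1)])
    let ?Q = "quotient_module T ?L" and ?q = "\<lambda>t. ?L +>\<^bsub>T\<^esub> t"
    have Q [simp]: "module R ?Q" by (rule T.quotient_module[OF L(1)])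
    interpret Q: module R ?Q by simp
    have q: "?q \<in> module_hom R T ?Q" by (rule T.quotient_proj_hom[OF L(1)])
    have mem: "?q t = \<zero>\<^bsub>?Q\<^esub> \<longleftrightarrow> t \<in> ?L" if "t \<in> carrier T" for t
      using that L.a_rcos_self[of t] L.a_rcos_const[of t] by (auto simp: quotient_module_def)
    define B where "B = (\<lambda>m n. ?q (pure R M N m n))"
    have B: "bilinear_map R M N ?Q B"
      unfolding B_def by (simp add: hom_comp[OF q])
    have bal: "B (ract m y) n = B m (N.lact y n)"
      if [simp]: "m \<in> carrier M" "y \<in> carrier H\<^sub>s" "n \<in> carrier N" for m y n
    proof -
      have "pure R M N (ract m y) n \<ominus>\<^bsub>T\<^esub> pure R M N m (N.lact y n) \<in> ?L"
        by (rule subsetD[OF L(2)]) (use that in blast)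
      then have "?q (pure R M N (ract m y) n \<ominus>\<^bsub>T\<^esub> pure R M N m (N.lact y n)) = \<zero>\<^bsub>?Q\<^esub>"
        by (subst mem) simp_all
      then show ?thesis
        by (simp add: T.module_hom_minus(2)[OF Q q] module_homD(1)[OF q] Q.M.a_minus_eq_zero_iff B_def)
    qed
    have lift: "tensor_lift R M N ?Q B t = ?q t" if [simp]: "t \<in> carrier T" for t
      using lift_push[of R M N T ?Q "pure R M N" ?q t] q by (simp add: B_def lift_pure_id)
    show "?K \<subseteq> ?L"
    proof
      fix t assume "t \<in> ?K"
      then have t: "t \<in> carrier T" "\<pi> t = \<zero>\<^bsub>T\<^esub>" by (auto simp: K)
      have "?q t = ?q (\<pi> t)"
        using balanced_proj[OF Q B bal t(1)] t(1) by (simp add: lift)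
      also have "\<dots> = \<zero>\<^bsub>?Q\<^esub>" using t(2) T.module_hom_zero[OF Q q] by simp
      finally show "t \<in> ?L" using mem t(1) by blast
    qed
  qed
qed

end

theorem corollary4p6:
  fixes R :: "('k, 'r) ring_scheme"
    and H :: "('k, 'h) module"
    and M :: "('k, 'm) module"
    and N :: "('k, 'n) module"
    and \<Delta> :: "'h \<Rightarrow> ('h \<times> 'h \<Rightarrow> 'k) set"
    and \<epsilon> :: "'h \<Rightarrow> 'k"
    and \<rho> :: "'m \<Rightarrow> ('m \<times> 'h \<Rightarrow> 'k) set"
    and \<sigma> :: "'n \<Rightarrow> ('n \<times> 'h \<Rightarrow> 'k) set"
  assumes "weak_bialgebra R H \<Delta> \<epsilon>"
    and "right_comodule R H \<Delta> \<epsilon> M \<rho>"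
    and "right_comodule R H \<Delta> \<epsilon> N \<sigma>"
  shows
    "bimodule R (source_base R H \<Delta> \<epsilon>) M
       (source_left_act R H \<epsilon> M \<rho>) (source_right_act R H \<epsilon> M \<rho>)
   \<and> bimodule R (source_base R H \<Delta> \<epsilon>) N
       (source_left_act R H \<epsilon> N \<sigma>) (source_right_act R H \<epsilon> N \<sigma>)
   \<and> bicomodule R (source_base R H \<Delta> \<epsilon>) (source_comult R H \<Delta> \<epsilon>) \<epsilon> M
       (source_left_coact R H \<Delta> \<epsilon> M \<rho>) (source_right_coact R H \<Delta> \<epsilon> M \<rho>)
   \<and> bicomodule R (source_base R H \<Delta> \<epsilon>) (source_comult R H \<Delta> \<epsilon>) \<epsilon> N
       (source_left_coact R H \<Delta> \<epsilon> N \<sigma>) (source_right_coact R H \<Delta> \<epsilon> N \<sigma>)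
   \<and> submodule (tensor_image R H \<epsilon> M \<rho> N \<sigma>) R (tensor R M N)
   \<and> cotensor R (source_base R H \<Delta> \<epsilon>)
         M (source_right_coact R H \<Delta> \<epsilon> M \<rho>) N (source_left_coact R H \<Delta> \<epsilon> N \<sigma>)
       = tensor_image R H \<epsilon> M \<rho> N \<sigma>
   \<and> (\<lambda>X. the_elem (tensor_proj R H \<epsilon> M \<rho> N \<sigma> ` X))
       \<in> module_iso R (tensor_coimage R H \<epsilon> M \<rho> N \<sigma>)
           ((tensor R M N)\<lparr>carrier := tensor_image R H \<epsilon> M \<rho> N \<sigma>\<rparr>)
   \<and> tensor_coimage R H \<epsilon> M \<rho> N \<sigma>
       = balanced_tensor R (source_base R H \<Delta> \<epsilon>)
           M (source_right_act R H \<epsilon> M \<rho>) N (source_left_act R H \<epsilon> N \<sigma>)"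
proof -
  interpret weak_bialgebra_comodules R H \<Delta> \<epsilon> M \<rho> N \<sigma>
    by (intro weak_bialgebra_comodules.intro weak_bialgebra_comodule.intro assms)
  interpret T: module R "tensor R M N" by simp
  show ?thesis
  proof (intro conjI)
    show "submodule (tensor_image R H \<epsilon> M \<rho> N \<sigma>) R (tensor R M N)"
      unfolding tensor_image_def by (rule T.hom_image_submodule[OF T.module_axioms proj_hom])
    show "(\<lambda>X. the_elem (tensor_proj R H \<epsilon> M \<rho> N \<sigma> ` X))
        \<in> module_iso R (tensor_coimage R H \<epsilon> M \<rho> N \<sigma>)
            ((tensor R M N)\<lparr>carrier := tensor_image R H \<epsilon> M \<rho> N \<sigma>\<rparr>)"
      unfolding tensor_image_def tensor_coimage_def
      by (rule T.first_isomorphism[OF T.module_axioms proj_hom])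
    show "tensor_coimage R H \<epsilon> M \<rho> N \<sigma>
        = balanced_tensor R (source_base R H \<Delta> \<epsilon>)
            M (source_right_act R H \<epsilon> M \<rho>) N (source_left_act R H \<epsilon> N \<sigma>)"
      unfolding tensor_coimage_def balanced_tensor_def kernel_eq_balanced ..
  qed (rule source_bimodule N.source_bimodule source_bicomodule N.source_bicomodule cotensor_eq_image)+
qed

end
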